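(* Let $n\in\mathbb N$ (finite, $n\ge 1$), let $A\in\mathscr V_n(\mathcal H_A)$ and $B\in\mathscr V_n(\mathcal H_B)$, and let $\mathscr H_A$, $\mathscr H_B$ be abstract model spaces for $A$, $B$, with associated partial isometries $\mathfrak Z_A$ on $\mathscr H_A$ and $\mathfrak Z_B$ on $\mathscr H_B$. Then the following are equivalent: (1) $A\preccurlyeq_q B$; (2) $\mathfrak Z_A\preccurlyeq_q\mathfrak Z_B$; (3) there exists a multiplier from $\mathscr H_A$ to $\mathscr H_B$, i.e. an analytic function $R:\mathbb C\setminus\mathbb T\to M_n(\mathbb C)$ such that $R\mathscr H_A\subset\mathscr H_B$ (that is, $Rf\in\mathscr H_B$ for every $f\in\mathscr H_A$).
   Context: All Hilbert spaces are complex and separable. $\mathbb T$ is the unit circle and $M_n(\mathbb C)$ is the set of complex $n\times n$ matrices. A bounded operator $V$ on $\mathcal H$ is a partial isometry if it is isometric on $\ker(V)^\perp$. It is completely non-unitary if there is no nonzero subspace $\mathcal M$ reducing $V$ such that $V|_{\mathcal M}$ is unitary on $\mathcal M$. $\mathscr V_n(\mathcal H)$ is the set of completely non-unitary partial isometries $V$ on $\mathcal H$ with $\dim\ker(V)=\dim\operatorname{Ran}(V)^\perp=n$. For $V\in\mathscr V_n(\mathcal H)$ and $\lambda\in\mathbb C\setminus\mathbb T$ put $\widetilde{\operatorname{Ran}}(V-\lambda I):=(V-\lambda I)\ker(V)^\perp$; its orthogonal complement has dimension $n$. A model for $V$ is an anti-analytic map $\Gamma:\mathbb C\setminus\mathbb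 T\to\mathcal B(\mathbb C^n,\mathcal H)$ such that, for each $\lambda$, $\Gamma(\lambda)$ is a linear bijection from $\mathbb C^n$ onto $\widetilde{\operatorname{Ran}}(V-\lambda I)^\perp$. (Models exist: if $U$ is a unitary extension of $V|_{\ker(V)^\perp}$ to $\mathcal H$ and $j:\mathbb C^n\to\operatorname{Ran}(V)^\perp$ is a linear isomorphism, then $\Gamma(\lambda)=(I-\overline\lambda U)^{-1}j$ is one; and since $V$ is completely non-unitary, the ranges of $\Gamma(\lambda)$, $\lambda\in\mathbb C\setminus\mathbb T$, span a dense subspace of $\mathcal H$.) For $f\in\mathcal H$ let $\widehat f(\lambda)=\Gamma(\lambda)^*f$. The abstract model space of $V$ for $\Gamma$ is $\mathscr H_V=\mathscr H_{V,\Gamma}=\{\widehat f: f\in\mathcal H\}$ with $\langle\widehat f,\widehat g\rangle:=\langle f,g\rangle$, a Hilbert space of $\mathbb C^n$-valued analytic functions on $\mathbb C\setminus\mathbb T$. $\mathfrak Z_V$ is the partial isometry on $\mathscr H_V$ that acts as $f\mapsto zf$ on the (closed) subspace $\{f\in\mathscr H_V: zf\in\mathscr H_V\}$ and as $0$ on its orthogonal complement; it belongs to $\mathscr V_n(\mathscr H_V)$ and is unitarily equivalent to $V$. For $A\in\mathscr V_n(\mathcal H_A)$, $B\in\mathscr V_n(\mathcal H_B)$, write $A\preccurlyeq_q B$ if there is an injective bounded linear map $X:\mathcal H_A\to\mathcal H_B$ with $X\ker(A)^\perp\subset\ker(B)^\perp$ and $XA|_{\ker(A)^\perp}=BX|_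{\ker(A)^\perp}$.
   Formalization: In (3) the multiplier R is additionally required to act injectively on the model space of A (Rf = Rg implies f = g); as written, R = 0 always satisfies (3), while (1) can fail, e.g. A the 2×2 nilpotent Jordan block on C^2 and B = 0 on C. *)

theory Defs
  imports "HOL-Analysis.Analysis" "HOL-Library.Function_Algebras"
begin

section \<open>Hilbert spaces\<close>

text \<open>
  A model space is a space of functions that depends on the operator it models, so it cannot be
  a type. A complex Hilbert space is therefore given by a carrier inside an ambient complex vector
  space, with a scalar multiplication and an inner product that is linear in the first argument.
  Only the values of the inner product on the carrier are meaningful.
\<close>

record 'a hspace =
  hcarrier :: "'a set"
  hscale :: "complex \<Rightarrow> 'a \<Rightarrow> 'a"
  hinner :: "'a \<Rightarrow> 'a \<Rightarrow> complex"

definition hnorm :: "'a hspace \<Rightarrow> 'a \<Rightarrow> real" where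
  "hnorm H x = sqrt (Re (hinner H x x))"

text \<open>
  The locale \<open>Metric_space\<close> asks the distance to be symmetric and nonnegative on the
  whole type, whence the default value off the carrier.
\<close>

definition hdist :: "'a::ab_group_add hspace \<Rightarrow> 'a \<Rightarrow> 'a \<Rightarrow> real" where
  "hdist H x y = (if x \<in> hcarrier H \<and> y \<in> hcarrier H then hnorm H (x - y) else 0)"

definition htopology :: "'a::ab_group_add hspace \<Rightarrow> 'a topology" where
  "htopology H = Metric_space.mtopology (hcarrier H) (hdist H)"

locale pre_hilbert_space =
  fixes H :: "'a::ab_group_add hspace"
  assumes vector_space: "vector_space (hscale H)"
    and subspace: "module.subspace (hscale H) (hcarrier H)"
    and inner_add_left: "\<lbrakk>x \<in> hcarrier H; y \<in> hcarrier H; z \<in> hcarrier H\<rbrakk>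
      \<Longrightarrow> hinner H (x + y) z = hinner H x z + hinner H y z"
    and inner_scale_left: "\<lbrakk>x \<in> hcarrier H; y \<in> hcarrier H\<rbrakk>
      \<Longrightarrow> hinner H (hscale H c x) y = c * hinner H x y"
    and inner_commute: "\<lbrakk>x \<in> hcarrier H; y \<in> hcarrier H\<rbrakk>
      \<Longrightarrow> hinner H y x = cnj (hinner H x y)"
    and inner_pos: "\<lbrakk>x \<in> hcarrier H; x \<noteq> 0\<rbrakk> \<Longrightarrow> Re (hinner H x x) > 0"

locale separable_hilbert_space = pre_hilbert_space +
  assumes complete: "Metric_space.mcomplete (hcarrier H) (hdist H)"
    and separable: "separable_space (htopology H)"

definition complex_euclidean :: "(complex ^ 'n) hspace" where
  "complex_euclidean = \<lparr>hcarrier = UNIV, hscale = (*s), hinner = (\<lambda>v w. \<Sum>i\<in>UNIV. v $ i * cnj (w $ i))\<rparr>"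

definition orth :: "'a hspace \<Rightarrow> 'a set \<Rightarrow> 'a set" where
  "orth H S = {x \<in> hcarrier H. \<forall>y\<in>S. hinner H x y = 0}"

definition hproj :: "'a::ab_group_add hspace \<Rightarrow> 'a set \<Rightarrow> 'a \<Rightarrow> 'a" where
  "hproj H M x = (THE p. p \<in> M \<and> x - p \<in> orth H M)"

definition closed_subspace :: "'a::ab_group_add hspace \<Rightarrow> 'a set \<Rightarrow> bool" where
  "closed_subspace H M \<longleftrightarrow>
     M \<subseteq> hcarrier H \<and> module.subspace (hscale H) M \<and> closedin (htopology H) M"


section \<open>Bounded operators and partial isometries\<close>

definition bounded_operator :: "'a::ab_group_add hspace \<Rightarrow> 'b::ab_group_add hspace \<Rightarrow> ('a \<Rightarrow> 'b) \<Rightarrow> bool" where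
  "bounded_operator H K T \<longleftrightarrow>
     (\<forall>x\<in>hcarrier H. T x \<in> hcarrier K) \<and>
     (\<forall>x\<in>hcarrier H. \<forall>y\<in>hcarrier H. T (x + y) = T x + T y) \<and>
     (\<forall>c. \<forall>x\<in>hcarrier H. T (hscale H c x) = hscale K c (T x)) \<and>
     (\<exists>C. \<forall>x\<in>hcarrier H. hnorm K (T x) \<le> C * hnorm H x)"

definition adj :: "'a hspace \<Rightarrow> 'b hspace \<Rightarrow> ('a \<Rightarrow> 'b) \<Rightarrow> 'b \<Rightarrow> 'a" where
  "adj H K T y = (THE x. x \<in> hcarrier H \<and> (\<forall>v\<in>hcarrier H. hinner H v x = hinner K (T v) y))"

definition ker :: "'a::ab_group_add hspace \<Rightarrow> ('a \<Rightarrow> 'a) \<Rightarrow> 'a set" where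
  "ker H V = {x \<in> hcarrier H. V x = 0}"

definition ran :: "'a hspace \<Rightarrow> ('a \<Rightarrow> 'a) \<Rightarrow> 'a set" where
  "ran H V = V ` hcarrier H"

definition partial_isometry :: "'a::ab_group_add hspace \<Rightarrow> ('a \<Rightarrow> 'a) \<Rightarrow> bool" where
  "partial_isometry H V \<longleftrightarrow>
     bounded_operator H H V \<and> (\<forall>x\<in>orth H (ker H V). hnorm H (V x) = hnorm H x)"

definition reducing :: "'a::ab_group_add hspace \<Rightarrow> ('a \<Rightarrow> 'a) \<Rightarrow> 'a set \<Rightarrow> bool" where
  "reducing H V M \<longleftrightarrow> closed_subspace H M \<and> V ` M \<subseteq> M \<and> V ` orth H M \<subseteq> orth H M"

definition unitary_on :: "'a hspace \<Rightarrow> ('a \<Rightarrow> 'a) \<Rightarrow> 'a set \<Rightarrow> bool" where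
  "unitary_on H V M \<longleftrightarrow> V ` M = M \<and> (\<forall>x\<in>M. hnorm H (V x) = hnorm H x)"

definition completely_non_unitary :: "'a::ab_group_add hspace \<Rightarrow> ('a \<Rightarrow> 'a) \<Rightarrow> bool" where
  "completely_non_unitary H V \<longleftrightarrow> (\<nexists>M. reducing H V M \<and> M \<noteq> {0} \<and> unitary_on H V M)"

text \<open>
  The library dimension of an infinite-dimensional space is 0, so the following is the intended
  notion only for \<open>n \<ge> 1\<close>.
\<close>

definition cnu_partial_isometries :: "nat \<Rightarrow> 'a::ab_group_add hspace \<Rightarrow> ('a \<Rightarrow> 'a) set" where
  "cnu_partial_isometries n H =
     {V. partial_isometry H V \<and> completely_non_unitary H V \<and>
         vector_space.dim (hscale H) (ker H V) = n \<and>
         vector_space.dim (hscale H) (orth H (ran H V)) = n}"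

definition quasi_le :: "'a::ab_group_add hspace \<Rightarrow> ('a \<Rightarrow> 'a) \<Rightarrow> 'b::ab_group_add hspace \<Rightarrow> ('b \<Rightarrow> 'b) \<Rightarrow> bool" where
  "quasi_le H A K B \<longleftrightarrow>
     (\<exists>X. bounded_operator H K X \<and> inj_on X (hcarrier H) \<and>
          X ` orth H (ker H A) \<subseteq> orth K (ker K B) \<and>
          (\<forall>x\<in>orth H (ker H A). X (A x) = B (X x)))"


section \<open>Abstract model spaces\<close>

abbreviation off_circle :: "complex set" where
  "off_circle \<equiv> - sphere 0 1"

definition ran_tilde :: "'a::ab_group_add hspace \<Rightarrow> ('a \<Rightarrow> 'a) \<Rightarrow> complex \<Rightarrow> 'a set" where
  "ran_tilde H V w = (\<lambda>x. V x - hscale H w x) ` orth H (ker H V)"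

text \<open>
  Differentiability in the conjugate variable with respect to the operator norm: the difference
  quotients by \<open>cnj (u - w)\<close> converge to \<open>D\<close> uniformly on the unit ball.
\<close>

definition anti_analytic_off_circle :: "'a::ab_group_add hspace \<Rightarrow> (complex \<Rightarrow> complex ^ 'n \<Rightarrow> 'a) \<Rightarrow> bool" where
  "anti_analytic_off_circle H \<Gamma> \<longleftrightarrow>
     (\<forall>w\<in>off_circle. \<exists>D. bounded_operator complex_euclidean H D \<and>
        (\<forall>\<epsilon>>0. \<exists>\<delta>>0. \<forall>u\<in>off_circle. dist u w < \<delta> \<longrightarrow>
           (\<forall>v. hnorm H (\<Gamma> u v - \<Gamma> w v - hscale H (cnj (u - w)) (D v))
                  \<le> \<epsilon> * dist u w * hnorm complex_euclidean v)))"

definition is_model :: "'a::ab_group_add hspace \<Rightarrow> ('a \<Rightarrow> 'a) \<Rightarrow> (complex \<Rightarrow> complex ^ 'n \<Rightarrow> 'a) \<Rightarrow> bool" where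
  "is_model H V \<Gamma> \<longleftrightarrow>
     anti_analytic_off_circle H \<Gamma> \<and>
     (\<forall>w\<in>off_circle. bounded_operator complex_euclidean H (\<Gamma> w) \<and>
        bij_betw (\<Gamma> w) UNIV (orth H (ran_tilde H V w)))"

text \<open>Functions on the complement of the unit circle are extended by 0 to the circle.\<close>

definition hat :: "'a hspace \<Rightarrow> (complex \<Rightarrow> complex ^ 'n \<Rightarrow> 'a) \<Rightarrow> 'a \<Rightarrow> complex \<Rightarrow> complex ^ 'n" where
  "hat H \<Gamma> f = (\<lambda>w. if w \<in> off_circle then adj complex_euclidean H (\<Gamma> w) f else 0)"

definition model_space :: "'a hspace \<Rightarrow> (complex \<Rightarrow> complex ^ 'n \<Rightarrow> 'a) \<Rightarrow> (complex \<Rightarrow> complex ^ 'n) hspace" where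
  "model_space H \<Gamma> =
     \<lparr>hcarrier = hat H \<Gamma> ` hcarrier H,
      hscale = (\<lambda>c F z. c *s F z),
      hinner = (\<lambda>F G. hinner H (inv_into (hcarrier H) (hat H \<Gamma>) F) (inv_into (hcarrier H) (hat H \<Gamma>) G))\<rparr>"

definition mult_z :: "(complex \<Rightarrow> complex ^ 'n) \<Rightarrow> complex \<Rightarrow> complex ^ 'n" where
  "mult_z F = (\<lambda>z. z *s F z)"

definition model_shift :: "(complex \<Rightarrow> complex ^ 'n) hspace \<Rightarrow> (complex \<Rightarrow> complex ^ 'n) \<Rightarrow> complex \<Rightarrow> complex ^ 'n" where
  "model_shift K F = mult_z (hproj K {G \<in> hcarrier K. mult_z G \<in> hcarrier K} F)"

definition mult_by :: "(complex \<Rightarrow> complex ^ 'n ^ 'n) \<Rightarrow> (complex \<Rightarrow> complex ^ 'n) \<Rightarrow> complex \<Rightarrow> complex ^ 'n" where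
  "mult_by R F = (\<lambda>z. R z *v F z)"

text \<open>
  The zero function is a multiplier between any two spaces, so the existence of a multiplier says
  something only together with the injectivity of \<open>mult_by R\<close> on the first space.
\<close>

definition is_multiplier :: "(complex \<Rightarrow> complex ^ 'n) hspace \<Rightarrow> (complex \<Rightarrow> complex ^ 'n) hspace \<Rightarrow> (complex \<Rightarrow> complex ^ 'n ^ 'n) \<Rightarrow> bool" where
  "is_multiplier K L R \<longleftrightarrow>
     (\<forall>i j. (\<lambda>z. R z $ i $ j) analytic_on off_circle) \<and>
     mult_by R ` hcarrier K \<subseteq> hcarrier L"

end

theory Submission
  imports Defs
begin

text \<open>
  The map \<open>f \<mapsto> hat f\<close> is injective because the intersection of the spaces
  \<open>(V - w) (ker V)\<^sup>\<bottom>\<close> over all \<open>w\<close> off the circle reduces \<open>V\<close> to a unitary operator and so is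
  zero. Hence it is a unitary map onto the model space, and it carries \<open>V\<close> to the model shift: if \<open>z (hat f) = hat g\<close>,
  then \<open>g - w f = (V - w) k\<^sub>w\<close> for some \<open>k\<^sub>w\<close> in \<open>(ker V)\<^sup>\<bottom>\<close>, and \<open>k\<^sub>w\<close> tends to \<open>f\<close> as \<open>w\<close> tends to
  infinity, whence \<open>f\<close> is in \<open>(ker V)\<^sup>\<bottom>\<close>. This transfers the order between operators and models.

  An intertwiner \<open>X\<close> maps \<open>(A - w) (ker A)\<^sup>\<bottom>\<close> into \<open>(B - w) (ker B)\<^sup>\<bottom>\<close>, so the value of
  \<open>hat (X f)\<close> at \<open>w\<close> depends only on the value of \<open>hat f\<close> there, which gives the matrix \<open>R w\<close>;
  locally \<open>R\<close> is a quotient of a matrix of functions in the second model by a Gram matrix of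
  functions in the first, so it is analytic. Conversely, multiplication by \<open>R\<close> has a formal adjoint
  on the total set of the vectors \<open>\<Gamma> w v\<close>, hence is bounded by the Baire category theorem.
\<close>

section \<open>Hilbert spaces\<close>

context pre_hilbert_space
begin

sublocale vs: vector_space "hscale H"
  by (rule vector_space)

abbreviation inner_H (\<open>\<langle>_,_\<rangle>\<close>) where "inner_H \<equiv> hinner H"

section \<open>Algebra of the inner product and the norm\<close>

lemma carrier_zero [simp]: "0 \<in> hcarrier H"
  and carrier_add [simp]: "x \<in> hcarrier H \<Longrightarrow> y \<in> hcarrier H \<Longrightarrow> x + y \<in> hcarrier H"
  and carrier_diff [simp]: "x \<in> hcarrier H \<Longrightarrow> y \<in> hcarrier H \<Longrightarrow> x - y \<in> hcarrier H"
  and carrier_minus [simp]: "x \<in> hcarrier H \<Longrightarrow> - x \<in> hcarrier H"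
  and carrier_scale [simp]: "x \<in> hcarrier H \<Longrightarrow> hscale H c x \<in> hcarrier H"
  using subspace
  by (auto simp: vs.subspace_0 vs.subspace_add vs.subspace_diff vs.subspace_neg vs.subspace_scale)

lemma inner_zero_left [simp]: "x \<in> hcarrier H \<Longrightarrow> \<langle>0,x\<rangle> = 0"
  using inner_scale_left[of 0 x 0] by simp

lemma inner_minus_left [simp]:
  "x \<in> hcarrier H \<Longrightarrow> y \<in> hcarrier H \<Longrightarrow> \<langle>- x,y\<rangle> = - \<langle>x,y\<rangle>"
  using inner_scale_left[of x y "-1"] by simp

lemma inner_diff_left:
  "x \<in> hcarrier H \<Longrightarrow> y \<in> hcarrier H \<Longrightarrow> z \<in> hcarrier H \<Longrightarrow> \<langle>x - y,z\<rangle> = \<langle>x,z\<rangle> - \<langle>y,z\<rangle>"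
  using inner_add_left[of x "- y" z] by simp

lemma inner_zero_right [simp]: "x \<in> hcarrier H \<Longrightarrow> \<langle>x,0\<rangle> = 0"
  using inner_commute[of 0 x] by simp

lemma inner_add_right:
  "x \<in> hcarrier H \<Longrightarrow> y \<in> hcarrier H \<Longrightarrow> z \<in> hcarrier H \<Longrightarrow> \<langle>x,y + z\<rangle> = \<langle>x,y\<rangle> + \<langle>x,z\<rangle>"
  using inner_commute[of "y + z" x] inner_commute[of y x] inner_commute[of z x]
  by (simp add: inner_add_left)

lemma inner_scale_right:
  "x \<in> hcarrier H \<Longrightarrow> y \<in> hcarrier H \<Longrightarrow> \<langle>x,hscale H c y\<rangle> = cnj c * \<langle>x,y\<rangle>"
  using inner_commute[of "hscale H c y" x] inner_commute[of y x] by (simp add: inner_scale_left)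

lemma inner_diff_right:
  "x \<in> hcarrier H \<Longrightarrow> y \<in> hcarrier H \<Longrightarrow> z \<in> hcarrier H \<Longrightarrow> \<langle>x,y - z\<rangle> = \<langle>x,y\<rangle> - \<langle>x,z\<rangle>"
  using inner_commute[of "y - z" x] inner_commute[of y x] inner_commute[of z x]
  by (simp add: inner_diff_left)

lemmas inner_simps = inner_add_left inner_diff_left inner_scale_left
  inner_add_right inner_diff_right inner_scale_right

lemma inner_sym_eq_0: "x \<in> hcarrier H \<Longrightarrow> y \<in> hcarrier H \<Longrightarrow> \<langle>x,y\<rangle> = 0 \<longleftrightarrow> \<langle>y,x\<rangle> = 0"
  using inner_commute[of x y] by simp

lemma inner_self_nonneg: "x \<in> hcarrier H \<Longrightarrow> 0 \<le> Re \<langle>x,x\<rangle>"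
  using inner_pos[of x] by (cases "x = 0") auto

lemma hnorm_power2: "x \<in> hcarrier H \<Longrightarrow> (hnorm H x)\<^sup>2 = Re \<langle>x,x\<rangle>"
  by (simp add: hnorm_def inner_self_nonneg)

lemma inner_self: "x \<in> hcarrier H \<Longrightarrow> \<langle>x,x\<rangle> = complex_of_real ((hnorm H x)\<^sup>2)"
  using inner_commute[of x x] by (simp add: hnorm_power2 complex_eq_iff)

lemma hnorm_nonneg [simp]: "x \<in> hcarrier H \<Longrightarrow> 0 \<le> hnorm H x"
  by (simp add: hnorm_def inner_self_nonneg)

lemma hnorm_zero [simp]: "hnorm H 0 = 0"
  by (simp add: hnorm_def)

lemma hnorm_eq_0 [simp]: "x \<in> hcarrier H \<Longrightarrow> hnorm H x = 0 \<longleftrightarrow> x = 0"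
  using inner_pos[of x] by (cases "x = 0") (auto simp: hnorm_def)

lemma hnorm_scale [simp]: "x \<in> hcarrier H \<Longrightarrow> hnorm H (hscale H c x) = cmod c * hnorm H x"
proof -
  assume x: "x \<in> hcarrier H"
  have "\<langle>hscale H c x,hscale H c x\<rangle> = (c * cnj c) * \<langle>x,x\<rangle>"
    using x by (simp add: inner_scale_left inner_scale_right)
  also have "\<dots> = complex_of_real ((cmod c)\<^sup>2 * (hnorm H x)\<^sup>2)"
    using x by (simp only: inner_self complex_norm_square[symmetric] of_real_mult)
  finally have "\<langle>hscale H c x,hscale H c x\<rangle> = complex_of_real ((cmod c)\<^sup>2 * (hnorm H x)\<^sup>2)" .
  then show ?thesis
    using x by (simp add: hnorm_def[of H "hscale H c x"] real_sqrt_mult)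
qed

lemma hnorm_minus [simp]: "x \<in> hcarrier H \<Longrightarrow> hnorm H (- x) = hnorm H x"
  using hnorm_scale[of x "-1"] by simp

lemma hnorm_minus_commute:
  "x \<in> hcarrier H \<Longrightarrow> y \<in> hcarrier H \<Longrightarrow> hnorm H (x - y) = hnorm H (y - x)"
  using hnorm_minus[of "x - y"] by simp

lemma hnorm_diff_power2:
  assumes "x \<in> hcarrier H" "y \<in> hcarrier H"
  shows "(hnorm H (x - y))\<^sup>2 = (hnorm H x)\<^sup>2 - 2 * Re \<langle>x,y\<rangle> + (hnorm H y)\<^sup>2"
  using assms inner_commute[of x y] by (simp add: hnorm_power2 inner_simps)

lemma hnorm_add_power2:
  assumes "x \<in> hcarrier H" "y \<in> hcarrier H"
  shows "(hnorm H (x + y))\<^sup>2 = (hnorm H x)\<^sup>2 + 2 * Re \<langle>x,y\<rangle> + (hnorm H y)\<^sup>2"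
  using assms inner_commute[of x y] by (simp add: hnorm_power2 inner_simps)

lemma Cauchy_Schwarz:
  assumes x: "x \<in> hcarrier H" and y: "y \<in> hcarrier H"
  shows "cmod \<langle>x,y\<rangle> \<le> hnorm H x * hnorm H y"
proof (cases "y = 0")
  case False
  \<comment> \<open>The coefficient for which \<open>hscale H c y\<close> is the projection of
    \<open>x\<close> onto the line through \<open>y\<close>. The inequality expresses that
    \<open>x\<close> minus this projection has nonnegative squared norm.\<close>
  define c where "c = \<langle>x,y\<rangle> / complex_of_real ((hnorm H y)\<^sup>2)"
  have n: "hnorm H y > 0"
    using False y by (simp add: less_le)
  have "\<langle>x,hscale H c y\<rangle> = complex_of_real ((cmod \<langle>x,y\<rangle>)\<^sup>2 / (hnorm H y)\<^sup>2)"
    unfolding c_def using x y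
    by (subst inner_scale_right) (simp_all add: complex_norm_square mult.commute del: of_real_power)
  then have "0 \<le> (hnorm H x)\<^sup>2 - 2 * ((cmod \<langle>x,y\<rangle>)\<^sup>2 / (hnorm H y)\<^sup>2) + (cmod c * hnorm H y)\<^sup>2"
    using hnorm_diff_power2[of x "hscale H c y"] x y by (metis Re_complex_of_real carrier_scale hnorm_scale zero_le_power2)
  moreover have "(cmod c * hnorm H y)\<^sup>2 = (cmod \<langle>x,y\<rangle>)\<^sup>2 / (hnorm H y)\<^sup>2"
    using n by (simp add: c_def norm_divide norm_mult power2_eq_square)
  ultimately have "(cmod \<langle>x,y\<rangle>)\<^sup>2 / (hnorm H y)\<^sup>2 \<le> (hnorm H x)\<^sup>2"
    by simp
  then have "(cmod \<langle>x,y\<rangle>)\<^sup>2 \<le> (hnorm H x * hnorm H y)\<^sup>2"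
    using n by (simp add: field_simps)
  then show ?thesis
    by (rule power2_le_imp_le) (simp add: x y)
qed (use x in simp)

lemma hnorm_triangle:
  assumes x: "x \<in> hcarrier H" and y: "y \<in> hcarrier H"
  shows "hnorm H (x + y) \<le> hnorm H x + hnorm H y"
proof (rule power2_le_imp_le)
  have "Re \<langle>x,y\<rangle> \<le> hnorm H x * hnorm H y"
    using Cauchy_Schwarz[OF x y] complex_Re_le_cmod order_trans by blast
  then show "(hnorm H (x + y))\<^sup>2 \<le> (hnorm H x + hnorm H y)\<^sup>2"
    using x y by (simp add: hnorm_add_power2 power2_sum)
qed (use x y in simp)

lemma hnorm_triangle_diff:
  assumes "x \<in> hcarrier H" "y \<in> hcarrier H" "z \<in> hcarrier H"
  shows "hnorm H (x - z) \<le> hnorm H (x - y) + hnorm H (y - z)"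
  using hnorm_triangle[of "x - y" "y - z"] assms by simp

lemma hnorm_triangle_ineq2:
  assumes "x \<in> hcarrier H" "y \<in> hcarrier H"
  shows "\<bar>hnorm H x - hnorm H y\<bar> \<le> hnorm H (x - y)"
  using hnorm_triangle[of "x - y" y] hnorm_triangle[of "y - x" x] hnorm_minus_commute[of x y] assms
  by auto

section \<open>Metric structure and sequential convergence\<close>

sublocale ms: Metric_space "hcarrier H" "hdist H"
proof
  fix x y z
  show "0 \<le> hdist H x y"
    by (simp add: hdist_def)
  show "hdist H x y = hdist H y x"
    by (simp add: hdist_def hnorm_minus_commute)
  show "x \<in> hcarrier H \<Longrightarrow> y \<in> hcarrier H \<Longrightarrow> (hdist H x y = 0) = (x = y)"
    by (simp add: hdist_def)
  show "x \<in> hcarrier H \<Longrightarrow> y \<in> hcarrier H \<Longrightarrow> z \<in> hcarrier H \<Longrightarrow>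
      hdist H x z \<le> hdist H x y + hdist H y z"
    by (simp add: hdist_def hnorm_triangle_diff)
qed

text \<open>Convergence in norm with every term in the carrier, whereas \<open>limitin\<close> asks
  this only of almost all terms. It reduces closedness to estimates of \<open>hnorm\<close> along
  sequences.\<close>

definition tends :: "(nat \<Rightarrow> 'a) \<Rightarrow> 'a \<Rightarrow> bool" where
  "tends s x \<longleftrightarrow> range s \<subseteq> hcarrier H \<and> x \<in> hcarrier H \<and> (\<lambda>k. hnorm H (s k - x)) \<longlonglongrightarrow> 0"

lemma limitin_iff_tends:
  assumes "range s \<subseteq> hcarrier H"
  shows "limitin (htopology H) s x sequentially \<longleftrightarrow> tends s x"
proof -
  have "s k \<in> hcarrier H \<and> hdist H (s k) x < e \<longleftrightarrow> dist (hnorm H (s k - x)) 0 < e"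
    if "x \<in> hcarrier H" for e k
    using assms that by (auto simp: hdist_def image_subset_iff)
  then show ?thesis
    using assms unfolding htopology_def ms.limitin_metric tends_def tendsto_iff by auto
qed

lemma closedin_sequentially:
  "closedin (htopology H) S \<longleftrightarrow>
     S \<subseteq> hcarrier H \<and> (\<forall>s x. range s \<subseteq> S \<and> tends s x \<longrightarrow> x \<in> S)"
proof -
  have "closedin (htopology H) S \<longleftrightarrow> S \<subseteq> hcarrier H \<and>
      (\<forall>s x. range s \<subseteq> S \<and> limitin (htopology H) s x sequentially \<longrightarrow> x \<in> S)"
    unfolding htopology_def by (rule ms.metric_closedin_iff_sequentially_closed)
  also have "\<dots> \<longleftrightarrow> S \<subseteq> hcarrier H \<and> (\<forall>s x. range s \<subseteq> S \<and> tends s x \<longrightarrow> x \<in> S)"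
    by (meson limitin_iff_tends order_trans)
  finally show ?thesis .
qed

lemma tends_unique: "tends s x \<Longrightarrow> tends s y \<Longrightarrow> x = y"
  by (metis limitin_iff_tends ms.limitin_metric_unique htopology_def tends_def trivial_limit_sequentially)

lemma tends_const [simp]: "x \<in> hcarrier H \<Longrightarrow> tends (\<lambda>k. x) x"
  by (simp add: tends_def image_subset_iff)

lemma tends_diff:
  assumes s: "tends s x" and t: "tends t y"
  shows "tends (\<lambda>k. s k - t k) (x - y)"
proof -
  have c: "s k \<in> hcarrier H" "t k \<in> hcarrier H" "x \<in> hcarrier H" "y \<in> hcarrier H" for k
    using s t by (auto simp: tends_def)
  have "hnorm H (s k - t k - (x - y)) \<le> hnorm H (s k - x) + hnorm H (t k - y)" for k
  proof -
    have "s k - t k - (x - y) = (s k - x) + (y - t k)"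
      by simp
    then show ?thesis
      using hnorm_triangle[of "s k - x" "y - t k"] hnorm_minus_commute[of "t k" y] c
      by (metis carrier_diff)
  qed
  moreover have "(\<lambda>k. hnorm H (s k - x) + hnorm H (t k - y)) \<longlonglongrightarrow> 0"
    using tendsto_add[of "\<lambda>k. hnorm H (s k - x)" 0 _ "\<lambda>k. hnorm H (t k - y)" 0] s t
    by (simp add: tends_def)
  ultimately have "(\<lambda>k. hnorm H (s k - t k - (x - y))) \<longlonglongrightarrow> 0"
    by - (rule Lim_null_comparison[OF always_eventually], simp_all add: c)
  then show ?thesis
    using c by (auto simp: tends_def)
qed

lemma tends_scale: "tends s x \<Longrightarrow> tends (\<lambda>k. hscale H c (s k)) (hscale H c x)"
proof -
  assume s: "tends s x"
  then have c: "s k \<in> hcarrier H" "x \<in> hcarrier H" for k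
    by (auto simp: tends_def)
  have "(\<lambda>k. cmod c * hnorm H (s k - x)) \<longlonglongrightarrow> 0"
    using s tendsto_mult_left[of "\<lambda>k. hnorm H (s k - x)" 0 _ "cmod c"] by (simp add: tends_def)
  then show ?thesis
    using c by (auto simp: tends_def simp flip: vs.scale_right_diff_distrib)
qed

lemma tends_inner:
  assumes s: "tends s x" and y: "y \<in> hcarrier H"
  shows "(\<lambda>k. \<langle>s k,y\<rangle>) \<longlonglongrightarrow> \<langle>x,y\<rangle>"
proof -
  have c: "s k \<in> hcarrier H" "x \<in> hcarrier H" for k
    using s by (auto simp: tends_def)
  have "norm (\<langle>s k,y\<rangle> - \<langle>x,y\<rangle>) \<le> hnorm H (s k - x) * hnorm H y" for k
    using Cauchy_Schwarz[of "s k - x" y] c y by (simp add: inner_simps)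
  moreover have "(\<lambda>k. hnorm H (s k - x) * hnorm H y) \<longlonglongrightarrow> 0"
    using s tendsto_mult_right[of "\<lambda>k. hnorm H (s k - x)" 0 _ "hnorm H y"] by (simp add: tends_def)
  ultimately show ?thesis
    by - (subst Lim_null, rule Lim_null_comparison[OF always_eventually], simp_all)
qed

lemma tends_hnorm:
  assumes s: "tends s x"
  shows "(\<lambda>k. hnorm H (s k)) \<longlonglongrightarrow> hnorm H x"
proof -
  have c: "s k \<in> hcarrier H" "x \<in> hcarrier H" for k
    using s by (auto simp: tends_def)
  have "norm (hnorm H (s k) - hnorm H x) \<le> hnorm H (s k - x)" for k
    using c by (simp add: hnorm_triangle_ineq2)
  moreover have "(\<lambda>k. hnorm H (s k - x)) \<longlonglongrightarrow> 0"
    using s by (simp add: tends_def)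
  ultimately show ?thesis
    by (metis (no_types, lifting) Lim_null Lim_null_comparison always_eventually)
qed

section \<open>Orthogonal complements\<close>

lemma orth_subset_carrier: "orth H S \<subseteq> hcarrier H"
  by (auto simp: orth_def)

lemma orth_subspace: "S \<subseteq> hcarrier H \<Longrightarrow> vs.subspace (orth H S)"
  by (rule vs.subspaceI) (auto simp: orth_def inner_simps subset_iff)

lemma orth_tends:
  assumes "S \<subseteq> hcarrier H" "range s \<subseteq> orth H S" "tends s x"
  shows "x \<in> orth H S"
proof -
  have "\<langle>x,y\<rangle> = 0" if "y \<in> S" for y
  proof -
    have "(\<lambda>k. \<langle>s k,y\<rangle>) = (\<lambda>k. 0)"
      using assms(2) that by (auto simp: orth_def)
    then show ?thesis
      using tends_inner[OF assms(3), of y] assms(1) that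
      by (metis LIMSEQ_unique subsetD tendsto_const)
  qed
  then show ?thesis
    using assms(3) by (auto simp: orth_def tends_def)
qed

lemma subset_orth_orth: "S \<subseteq> hcarrier H \<Longrightarrow> S \<subseteq> orth H (orth H S)"
  by (auto simp: orth_def) (use inner_sym_eq_0 in blast)

lemma orth_antimono: "S \<subseteq> T \<Longrightarrow> orth H T \<subseteq> orth H S"
  by (auto simp: orth_def)

lemma orth_inter_self: "x \<in> S \<Longrightarrow> x \<in> orth H S \<Longrightarrow> x = 0"
  using inner_pos[of x] by (fastforce simp: orth_def)

end

section \<open>Completeness and orthogonal projection\<close>

locale hilbert_space = pre_hilbert_space +
  assumes mcomplete: "Metric_space.mcomplete (hcarrier H) (hdist H)"
begin

lemma Cauchy_tends:
  assumes c: "range s \<subseteq> hcarrier H"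
    and s: "\<And>e. e > 0 \<Longrightarrow> \<exists>N. \<forall>m\<ge>N. \<forall>k\<ge>N. hnorm H (s m - s k) < e"
  shows "\<exists>x. tends s x"
proof -
  have "hdist H (s m) (s k) = hnorm H (s m - s k)" for m k
    using c by (auto simp: hdist_def)
  then have "ms.MCauchy s"
    using c s unfolding ms.MCauchy_def by auto
  then show ?thesis
    using mcomplete c unfolding ms.mcomplete_def htopology_def[symmetric] by (metis limitin_iff_tends)
qed

text \<open>A minimising sequence for the distance from \<open>x\<close> to \<open>M\<close> is
  Cauchy, and its limit is the projection of \<open>x\<close> onto the closure of \<open>M\<close>.
  The limit may leave \<open>M\<close>, so the sequence is returned with it; this serves closed and
  dense subspaces alike.\<close>

lemma approx_projection:
  assumes x: "x \<in> hcarrier H" and M: "vs.subspace M" "M \<subseteq> hcarrier H"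
  obtains s p where "range s \<subseteq> M" "tends s p" "x - p \<in> orth H M"
proof -
  define d where "d = Inf ((\<lambda>m. (hnorm H (x - m))\<^sup>2) ` M)"
  have bdd: "bdd_below ((\<lambda>m. (hnorm H (x - m))\<^sup>2) ` M)"
    by (rule bdd_belowI[of _ 0]) auto
  have dle: "d \<le> (hnorm H (x - m))\<^sup>2" if "m \<in> M" for m
    unfolding d_def using that by (intro cInf_lower bdd) auto
  have "\<forall>k. \<exists>m\<in>M. (hnorm H (x - m))\<^sup>2 < d + inverse (real (Suc k))"
  proof
    fix k
    have "\<exists>r\<in>(\<lambda>m. (hnorm H (x - m))\<^sup>2) ` M. r < d + inverse (real (Suc k))"
      using vs.subspace_0[OF M(1)] by (intro cInf_lessD) (auto simp: d_def)
    then show "\<exists>m\<in>M. (hnorm H (x - m))\<^sup>2 < d + inverse (real (Suc k))"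
      by blast
  qed
  then obtain s where s: "\<And>k. s k \<in> M" "\<And>k. (hnorm H (x - s k))\<^sup>2 < d + inverse (real (Suc k))"
    by metis
  have sc: "s k \<in> hcarrier H" for k
    using s M by auto
  \<comment> \<open>The parallelogram law for \<open>x - s m\<close> and \<open>x - s k\<close>.
    Their sum is twice \<open>x\<close> minus the midpoint \<open>c\<close>, and \<open>c\<close>
    belongs to \<open>M\<close>, so its squared distance to \<open>x\<close> is at least
    \<open>d\<close>.\<close>
  have par: "(hnorm H (s m - s k))\<^sup>2 \<le> 2 * inverse (real (Suc m)) + 2 * inverse (real (Suc k))" for m k
  proof -
    define c where "c = hscale H (1/2) (s m + s k)"
    have "c \<in> M"
      unfolding c_def using M s by (simp add: vs.subspace_add vs.subspace_scale)
    have eq: "(x - s m) + (x - s k) = hscale H 2 (x - c)"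
      by (simp add: c_def vs.scale_right_diff_distrib)
         (metis (no_types, lifting) add_diff_add one_add_one vs.scale_left_distrib vs.scale_one)
    have c: "c \<in> hcarrier H"
      using \<open>c \<in> M\<close> M by auto
    have "(hnorm H (s m - s k))\<^sup>2 + (hnorm H ((x - s m) + (x - s k)))\<^sup>2
        = 2 * (hnorm H (x - s m))\<^sup>2 + 2 * (hnorm H (x - s k))\<^sup>2"
      using hnorm_diff_power2[of "x - s k" "x - s m"] hnorm_add_power2[of "x - s k" "x - s m"] x sc[of m] sc[of k]
      by (simp add: add.commute)
    moreover have "(hnorm H ((x - s m) + (x - s k)))\<^sup>2 = 4 * (hnorm H (x - c))\<^sup>2"
      unfolding eq using x c by (simp add: power_mult_distrib)
    ultimately show ?thesis
      using s(2)[of m] s(2)[of k] dle[OF \<open>c \<in> M\<close>] by argo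
  qed
  have "\<exists>p. tends s p"
  proof (rule Cauchy_tends)
    fix e :: real
    assume "e > 0"
    then obtain N where N: "inverse (real (Suc N)) < e\<^sup>2 / 4"
      using reals_Archimedean[of "e\<^sup>2 / 4"] by auto
    have "hnorm H (s m - s k) < e" if "m \<ge> N" "k \<ge> N" for m k
    proof (rule power2_less_imp_less)
      have "inverse (real (Suc m)) \<le> inverse (real (Suc N))" "inverse (real (Suc k)) \<le> inverse (real (Suc N))"
        using that by (auto intro!: le_imp_inverse_le)
      then show "(hnorm H (s m - s k))\<^sup>2 < e\<^sup>2"
        using par[of m k] N by linarith
    qed (use \<open>e > 0\<close> in simp)
    then show "\<exists>N. \<forall>m\<ge>N. \<forall>k\<ge>N. hnorm H (s m - s k) < e"
      by blast
  qed (use sc in auto)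
  then obtain p where p: "tends s p"
    by blast
  have pc: "p \<in> hcarrier H"
    using p by (simp add: tends_def)
  have "tends (\<lambda>k. x - s k) (x - p)"
    by (rule tends_diff[OF tends_const[OF x] p])
  from tendsto_power[OF tends_hnorm[OF this], of 2]
  have l1: "(\<lambda>k. (hnorm H (x - s k))\<^sup>2) \<longlonglongrightarrow> (hnorm H (x - p))\<^sup>2" .
  have l2: "(\<lambda>k. d + inverse (real (Suc k))) \<longlonglongrightarrow> d + 0"
    by (intro tendsto_intros LIMSEQ_inverse_real_of_nat)
  have le: "(hnorm H (x - p))\<^sup>2 \<le> d"
    using LIMSEQ_le[OF l1 l2] s(2) less_imp_le by auto
  \<comment> \<open>The lower bound passes to the limit, since it holds for the vectors
    \<open>s k + m\<close> of \<open>M\<close>.\<close>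
  have low: "d \<le> (hnorm H (x - p - m))\<^sup>2" if "m \<in> M" for m
  proof -
    have mc: "m \<in> hcarrier H"
      using that M by auto
    have "tends (\<lambda>k. x - s k - m) (x - p - m)"
      by (rule tends_diff[OF \<open>tends (\<lambda>k. x - s k) (x - p)\<close> tends_const[OF mc]])
    from tendsto_power[OF tends_hnorm[OF this], of 2]
    have "(\<lambda>k. (hnorm H (x - s k - m))\<^sup>2) \<longlonglongrightarrow> (hnorm H (x - p - m))\<^sup>2" .
    moreover have "d \<le> (hnorm H (x - s k - m))\<^sup>2" for k
      using dle[of "s k + m"] that s(1)[of k] M by (simp add: vs.subspace_add diff_diff_eq)
    ultimately show ?thesis
      by (simp add: LIMSEQ_le_const)
  qed
  have "\<langle>x - p,m\<rangle> = 0" if "m \<in> M" for m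
  proof (rule ccontr)
    assume ne: "\<langle>x - p,m\<rangle> \<noteq> 0"
    have mc: "m \<in> hcarrier H"
      using that M by auto
    then have "m \<noteq> 0"
      using ne x pc by auto
    then have n: "hnorm H m > 0"
      using mc by (simp add: less_le)
    \<comment> \<open>Moving \<open>p\<close> by the projection of \<open>x - p\<close> onto the
      line through \<open>m\<close> would bring its squared distance to \<open>x\<close> below
      \<open>d\<close>.\<close>
    define c where "c = \<langle>x - p,m\<rangle> / complex_of_real ((hnorm H m)\<^sup>2)"
    have "hscale H c m \<in> M"
      using that M by (simp add: vs.subspace_scale)
    have i: "\<langle>x - p,hscale H c m\<rangle> = complex_of_real ((cmod \<langle>x - p,m\<rangle>)\<^sup>2 / (hnorm H m)\<^sup>2)"
      unfolding c_def using x pc mc by (subst inner_scale_right) (simp_all add: complex_norm_square mult.commute del: of_real_power)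
    have "(hnorm H (x - p - hscale H c m))\<^sup>2
        = (hnorm H (x - p))\<^sup>2 - 2 * ((cmod \<langle>x - p,m\<rangle>)\<^sup>2 / (hnorm H m)\<^sup>2) + (cmod c * hnorm H m)\<^sup>2"
      using hnorm_diff_power2[of "x - p" "hscale H c m"] x pc mc unfolding i by simp
    also have "(cmod c * hnorm H m)\<^sup>2 = (cmod \<langle>x - p,m\<rangle>)\<^sup>2 / (hnorm H m)\<^sup>2"
      using n by (simp add: c_def norm_divide norm_mult power2_eq_square)
    finally have "(cmod \<langle>x - p,m\<rangle>)\<^sup>2 / (hnorm H m)\<^sup>2 \<le> 0"
      using low[OF \<open>hscale H c m \<in> M\<close>] le by linarith
    then show False
      using n ne by (simp add: divide_le_0_iff)
  qed
  then have "x - p \<in> orth H M"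
    using x pc by (simp add: orth_def)
  with p s show ?thesis
    by (intro that[of s p]) auto
qed

lemma projection:
  assumes "x \<in> hcarrier H" "closed_subspace H M"
  obtains p where "p \<in> M" "x - p \<in> orth H M"
  using approx_projection[of x M] assms unfolding closed_subspace_def closedin_sequentially
  by metis

text \<open>A vector of the double complement differs from its projection onto \<open>M\<close> by a
  vector that lies both in \<open>orth H M\<close> and in the complement of that space, hence by
  0.\<close>

lemma orth_orth_closed_subspace: "closed_subspace H M \<Longrightarrow> orth H (orth H M) = M"
proof
  assume M: "closed_subspace H M"
  then have Mc: "M \<subseteq> hcarrier H"
    by (simp add: closed_subspace_def)
  show "M \<subseteq> orth H (orth H M)"
    by (rule subset_orth_orth[OF Mc])
  show "orth H (orth H M) \<subseteq> M"
  proof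
    fix x
    assume x: "x \<in> orth H (orth H M)"
    then obtain p where p: "p \<in> M" "x - p \<in> orth H M"
      using projection[OF _ M] orth_subset_carrier by blast
    have "x - p \<in> orth H (orth H M)"
      using x p subset_orth_orth[OF Mc] vs.subspace_diff orth_subspace orth_subset_carrier by (metis subsetD)
    then have "x - p = 0"
      using orth_inter_self[OF p(2)] by blast
    then show "x \<in> M"
      using p by simp
  qed
qed

text \<open>By density \<open>x\<close> is a limit of vectors of \<open>M\<close>. The bound, tested
  on these vectors, tends to \<open>cmod \<langle>x,x\<rangle> \<le> C * hnorm H x\<close>.\<close>

lemma hnorm_le_of_inner_bound:
  assumes x: "x \<in> hcarrier H" and M: "vs.subspace M" "M \<subseteq> hcarrier H"
    and dense: "orth H M = {0}"
    and bound: "\<And>y. y \<in> M \<Longrightarrow> cmod \<langle>x,y\<rangle> \<le> C * hnorm H y" and C: "0 \<le> C"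
  shows "hnorm H x \<le> C"
proof -
  obtain s p where s: "range s \<subseteq> M" "tends s p" "x - p \<in> orth H M"
    using approx_projection[OF x M] .
  then have "p = x"
    using dense by simp
  with s have t: "tends s x"
    by simp
  have "(\<lambda>k. cmod \<langle>s k,x\<rangle>) \<longlonglongrightarrow> cmod \<langle>x,x\<rangle>"
    by (intro tendsto_norm tends_inner[OF t x])
  moreover have "(\<lambda>k. C * hnorm H (s k)) \<longlonglongrightarrow> C * hnorm H x"
    by (intro tendsto_mult tendsto_const tends_hnorm[OF t])
  moreover have "cmod \<langle>s k,x\<rangle> \<le> C * hnorm H (s k)" for k
  proof -
    have "s k \<in> M" "s k \<in> hcarrier H"
      using s(1) M by auto
    then show ?thesis
      using bound[of "s k"] inner_commute[OF x, of "s k"] by simp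
  qed
  ultimately have "cmod \<langle>x,x\<rangle> \<le> C * hnorm H x"
    by (intro LIMSEQ_le) auto
  then have "hnorm H x * hnorm H x \<le> C * hnorm H x"
    using x by (simp add: inner_self norm_mult power2_eq_square)
  then show ?thesis
    using hnorm_nonneg[OF x] C by (cases "hnorm H x = 0") (auto simp: less_le)
qed

end

text \<open>A variant of the Hellinger-Toeplitz theorem: the formal adjoint makes the sets of
  vectors with \<open>hnorm K (T x) \<le> m\<close> closed, and by Baire one of them contains a
  ball. The set \<open>S\<close> is only asked to be total, so that it can consist of the vectors
  that represent point evaluations.\<close>

lemma bounded_if_formal_adjoint_dense:
  assumes H: "hilbert_space H" and K: "hilbert_space K"
    and T: "\<And>x. x \<in> hcarrier H \<Longrightarrow> T x \<in> hcarrier K"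
    and add: "\<And>x y. x \<in> hcarrier H \<Longrightarrow> y \<in> hcarrier H \<Longrightarrow> T (x + y) = T x + T y"
    and scale: "\<And>c x. x \<in> hcarrier H \<Longrightarrow> T (hscale H c x) = hscale K c (T x)"
    and S: "orth K S = {0}"
    and adjoint: "\<And>s. s \<in> S \<Longrightarrow>
      s \<in> hcarrier K \<and> (\<exists>h\<in>hcarrier H. \<forall>x\<in>hcarrier H. hinner K (T x) s = hinner H x h)"
  shows "bounded_operator H K T"
proof -
  interpret H: hilbert_space H by (rule H)
  interpret K: hilbert_space K by (rule K)
  \<comment> \<open>The domain of the formal adjoint. It is a subspace containing \<open>S\<close>,
    and so it is dense.\<close>
  define M where
    "M = {s \<in> hcarrier K. \<exists>h\<in>hcarrier H. \<forall>x\<in>hcarrier H. hinner K (T x) s = hinner H x h}"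
  have M: "M \<subseteq> hcarrier K"
    by (auto simp: M_def)
  have subM: "K.vs.subspace M"
  proof (rule K.vs.subspaceI)
    show "0 \<in> M"
      using T by (auto simp: M_def intro!: bexI[of _ 0])
  next
    fix s t
    assume "s \<in> M" "t \<in> M"
    then obtain g h where
      gh: "g \<in> hcarrier H" "h \<in> hcarrier H" "s \<in> hcarrier K" "t \<in> hcarrier K"
      and "\<forall>x\<in>hcarrier H. hinner K (T x) s = hinner H x g"
        "\<forall>x\<in>hcarrier H. hinner K (T x) t = hinner H x h"
      by (auto simp: M_def)
    then have "\<forall>x\<in>hcarrier H. hinner K (T x) (s + t) = hinner H x (g + h)"
      using T by (simp add: H.inner_simps K.inner_simps)
    with gh show "s + t \<in> M"
      unfolding M_def using H.carrier_add K.carrier_add by blast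
  next
    fix c s
    assume "s \<in> M"
    then obtain h where
      h: "h \<in> hcarrier H" "s \<in> hcarrier K" and "\<forall>x\<in>hcarrier H. hinner K (T x) s = hinner H x h"
      by (auto simp: M_def)
    then have "\<forall>x\<in>hcarrier H. hinner K (T x) (hscale K c s) = hinner H x (hscale H c h)"
      using T by (simp add: H.inner_simps K.inner_simps)
    with h show "hscale K c s \<in> M"
      unfolding M_def using H.carrier_scale K.carrier_scale by blast
  qed
  have "S \<subseteq> M"
    using adjoint by (auto simp: M_def)
  then have dense: "orth K M = {0}"
    using K.orth_antimono[of S M] S M by (auto simp: orth_def)
  \<comment> \<open>By density of \<open>M\<close> this is the set where
    \<open>hnorm K (T x) \<le> real m\<close>. Testing against \<open>M\<close> only is what makes
    it closed: there \<open>T\<close> can be moved to the other side, and the inner product of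
    \<open>H\<close> is continuous.\<close>
  define E where "E m = {x \<in> hcarrier H. \<forall>s\<in>M. cmod (hinner K (T x) s) \<le> real m * hnorm K s}" for m
  have E_bound: "hnorm K (T x) \<le> real m" if "x \<in> E m" for x m
    using that T by (intro K.hnorm_le_of_inner_bound[OF _ subM M dense]) (auto simp: E_def)
  have closed: "closedin (htopology H) (E m)" for m
    unfolding H.closedin_sequentially
  proof (intro conjI allI impI)
    show "E m \<subseteq> hcarrier H"
      by (auto simp: E_def)
    fix s x
    assume s: "range s \<subseteq> E m \<and> H.tends s x"
    then have x: "x \<in> hcarrier H" and sc: "\<And>k. s k \<in> hcarrier H"
      by (auto simp: H.tends_def)
    have "cmod (hinner K (T x) t) \<le> real m * hnorm K t" if t: "t \<in> M" for t
    proof -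
      obtain h where h: "h \<in> hcarrier H" "\<And>y. y \<in> hcarrier H \<Longrightarrow> hinner K (T y) t = hinner H y h"
        using t by (auto simp: M_def)
      have "(\<lambda>k. cmod (hinner H (s k) h)) \<longlonglongrightarrow> cmod (hinner H x h)"
        using s h by (intro tendsto_norm H.tends_inner) auto
      moreover have "cmod (hinner H (s k) h) \<le> real m * hnorm K t" for k
      proof -
        have "s k \<in> E m"
          using s by auto
        then show ?thesis
          using t h(2)[OF sc] by (auto simp: E_def)
      qed
      ultimately have "cmod (hinner H x h) \<le> real m * hnorm K t"
        by (intro LIMSEQ_le_const2) auto
      then show ?thesis
        using h x by simp
    qed
    then show "x \<in> E m"
      using x by (simp add: E_def)
  qed
  have "hcarrier H \<subseteq> \<Union>(range E)"
  proof
    fix x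
    assume x: "x \<in> hcarrier H"
    obtain m :: nat where m: "hnorm K (T x) \<le> real m"
      using real_arch_simple by blast
    have "cmod (hinner K (T x) s) \<le> real m * hnorm K s" if "s \<in> M" for s
    proof -
      have "cmod (hinner K (T x) s) \<le> hnorm K (T x) * hnorm K s"
        using that M T x by (intro K.Cauchy_Schwarz) auto
      also have "\<dots> \<le> real m * hnorm K s"
        using that M m by (intro mult_right_mono K.hnorm_nonneg) auto
      finally show ?thesis .
    qed
    then show "x \<in> \<Union>(range E)"
      using x by (auto simp: E_def)
  qed
  then have U: "\<Union>(range E) = hcarrier H"
    by (auto simp: E_def)
  have "\<exists>m. H.ms.mtopology interior_of E m \<noteq> {}"
  proof (rule ccontr)
    assume "\<not> ?thesis"
    then have "H.ms.mtopology interior_of \<Union>(range E) = {}"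
      using closed H.mcomplete
      by (intro H.ms.metric_Baire_category_alt) (auto simp: htopology_def)
    moreover have "H.ms.mtopology interior_of hcarrier H = hcarrier H"
      by (metis H.ms.topspace_mtopology interior_of_topspace)
    ultimately show False
      using U H.carrier_zero by auto
  qed
  then obtain m x0 e where e: "e > 0" and x0: "x0 \<in> hcarrier H" and ball: "H.ms.mball x0 e \<subseteq> E m"
    unfolding H.ms.metric_interior_of by auto
  have "hnorm K (T y) \<le> 4 * real m / e * hnorm H y" if y: "y \<in> hcarrier H" for y
  proof (cases "y = 0")
    case True
    then show ?thesis
      using scale[of 0 0] by simp
  next
    case False
    \<comment> \<open>With this \<open>c\<close> the point \<open>z\<close> below has distance
      \<open>e / 2\<close> from \<open>x0\<close>, so both lie in the ball inside
      \<open>E m\<close>, and \<open>T y\<close> is controlled by the difference of their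
      images.\<close>
    define c where "c = e / (2 * hnorm H y)"
    have n: "hnorm H y > 0"
      using False y by (simp add: less_le)
    then have c: "c > 0"
      using e by (simp add: c_def)
    define z where "z = x0 + hscale H (complex_of_real c) y"
    have z: "z \<in> hcarrier H"
      using x0 y by (simp add: z_def)
    have "hdist H x0 z = c * hnorm H y"
      using x0 y z c H.hnorm_minus_commute[of x0 z] by (simp add: hdist_def z_def)
    then have "hdist H x0 z < e"
      using n e by (simp add: c_def)
    then have "z \<in> E m" "x0 \<in> E m"
      using ball x0 z e by (auto simp: subset_iff)
    then have b: "hnorm K (T z) \<le> real m" "hnorm K (T x0) \<le> real m"
      using E_bound by auto
    have "T z = T x0 + hscale K (complex_of_real c) (T y)"
      using x0 y by (simp add: z_def add scale)
    then have "hscale K (complex_of_real c) (T y) = T z - T x0"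
      by simp
    then have "c * hnorm K (T y) = hnorm K (T z - T x0)"
      using K.hnorm_scale[OF T[OF y], of "complex_of_real c"] c by simp
    also have "\<dots> \<le> hnorm K (T z) + hnorm K (T x0)"
      using K.hnorm_triangle[of "T z" "- T x0"] T z x0 by simp
    finally have "c * hnorm K (T y) \<le> 2 * real m"
      using b by simp
    then show ?thesis
      using n e by (simp add: c_def field_simps)
  qed
  then show ?thesis
    unfolding bounded_operator_def using T add scale by blast
qed

section \<open>Partial isometries\<close>

locale partial_isometry_space = hilbert_space +
  fixes V
  assumes partial_isometry: "partial_isometry H V"
begin

abbreviation "initial \<equiv> orth H (ker H V)"

lemma V_carrier [simp]: "x \<in> hcarrier H \<Longrightarrow> V x \<in> hcarrier H"
  and V_add: "x \<in> hcarrier H \<Longrightarrow> y \<in> hcarrier H \<Longrightarrow> V (x + y) = V x + V y"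
  and V_scale: "x \<in> hcarrier H \<Longrightarrow> V (hscale H c x) = hscale H c (V x)"
  and V_bounded: "\<exists>C. \<forall>x\<in>hcarrier H. hnorm H (V x) \<le> C * hnorm H x"
  and V_isometric: "x \<in> initial \<Longrightarrow> hnorm H (V x) = hnorm H x"
  using partial_isometry unfolding partial_isometry_def bounded_operator_def by auto

lemma V_zero [simp]: "V 0 = 0"
  using V_scale[of 0 0] by simp

lemma V_diff: "x \<in> hcarrier H \<Longrightarrow> y \<in> hcarrier H \<Longrightarrow> V (x - y) = V x - V y"
  using V_add[of "x - y" y] by (simp add: algebra_simps)

lemma V_tends: "tends s x \<Longrightarrow> tends (\<lambda>k. V (s k)) (V x)"
proof -
  assume s: "tends s x"
  then have c: "s k \<in> hcarrier H" "x \<in> hcarrier H" for k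
    by (auto simp: tends_def)
  obtain C where C: "\<And>x. x \<in> hcarrier H \<Longrightarrow> hnorm H (V x) \<le> C * hnorm H x"
    using V_bounded by auto
  have "norm (hnorm H (V (s k) - V x)) \<le> C * hnorm H (s k - x)" for k
    using C[of "s k - x"] c by (simp add: V_diff)
  moreover have "(\<lambda>k. C * hnorm H (s k - x)) \<longlonglongrightarrow> 0"
    using s tendsto_mult_left[of "\<lambda>k. hnorm H (s k - x)" 0 _ C] by (simp add: tends_def)
  ultimately have "(\<lambda>k. hnorm H (V (s k) - V x)) \<longlonglongrightarrow> 0"
    by (metis (no_types, lifting) Lim_null_comparison always_eventually)
  then show ?thesis
    using c by (auto simp: tends_def)
qed

lemma ker_subset: "ker H V \<subseteq> hcarrier H"
  by (auto simp: ker_def)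

lemma ker_closed_subspace: "closed_subspace H (ker H V)"
  unfolding closed_subspace_def closedin_sequentially
proof (intro conjI allI impI ker_subset)
  show "vs.subspace (ker H V)"
    by (rule vs.subspaceI) (auto simp: ker_def V_add V_scale)
  fix s x
  assume s: "range s \<subseteq> ker H V \<and> tends s x"
  then have "(\<lambda>k. V (s k)) = (\<lambda>k. 0)"
    by (auto simp: ker_def)
  then show "x \<in> ker H V"
    using V_tends[of s x] s tends_unique[of "\<lambda>k. 0" "V x" 0] by (auto simp: ker_def tends_def)
qed

lemma initial_subset: "initial \<subseteq> hcarrier H"
  by (rule orth_subset_carrier)

lemma initial_carrier: "x \<in> initial \<Longrightarrow> x \<in> hcarrier H"
  using initial_subset by auto

lemma initial_subspace: "vs.subspace initial"
  by (rule orth_subspace[OF ker_subset])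

lemma initial_tends: "range s \<subseteq> initial \<Longrightarrow> tends s x \<Longrightarrow> x \<in> initial"
  by (rule orth_tends[OF ker_subset])

lemma initial_component:
  assumes "x \<in> hcarrier H"
  obtains d where "d \<in> initial" "x - d \<in> ker H V" "V x = V d"
proof -
  obtain p where p: "p \<in> ker H V" "x - p \<in> initial"
    using projection[OF assms ker_closed_subspace] .
  moreover have "V (x - p) = V x"
    using V_diff[of x p] p(1) assms by (simp add: ker_def)
  ultimately show ?thesis
    by (intro that[of "x - p"]) auto
qed

text \<open>Polarisation: the squared norms of \<open>x + y\<close> and \<open>V x + V y\<close> are
  compared. The imaginary parts follow on replacing \<open>x\<close> by
  \<open>hscale H \<i> x\<close>.\<close>

lemma V_inner_Re:
  assumes "x \<in> initial" "y \<in> initial"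
  shows "Re \<langle>V x,V y\<rangle> = Re \<langle>x,y\<rangle>"
proof -
  have c: "x \<in> hcarrier H" "y \<in> hcarrier H"
    using assms initial_subset by auto
  have "x + y \<in> initial"
    using assms by (rule vs.subspace_add[OF initial_subspace])
  then have "hnorm H (V x + V y) = hnorm H (x + y)"
    using V_isometric c by (simp flip: V_add)
  then show ?thesis
    using hnorm_add_power2[of x y] hnorm_add_power2[of "V x" "V y"] c assms V_isometric by simp
qed

lemma V_inner_initial:
  assumes "x \<in> initial" "y \<in> initial"
  shows "\<langle>V x,V y\<rangle> = \<langle>x,y\<rangle>"
proof (rule complex_eqI)
  have c: "x \<in> hcarrier H" "y \<in> hcarrier H"
    using assms initial_subset by auto
  have "hscale H \<i> x \<in> initial"
    using assms(1) by (rule vs.subspace_scale[OF initial_subspace])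
  from V_inner_Re[OF this assms(2)] show "Im \<langle>V x,V y\<rangle> = Im \<langle>x,y\<rangle>"
    using c by (simp add: V_scale inner_simps)
qed (rule V_inner_Re[OF assms])

text \<open>The component of \<open>x\<close> in the kernel is annihilated by \<open>V\<close> and
  is orthogonal to \<open>y\<close>. This asymmetric form yields the invariance of the orthogonal
  complement of the unitary part.\<close>

lemma V_inner:
  assumes x: "x \<in> hcarrier H" and y: "y \<in> initial"
  shows "\<langle>V x,V y\<rangle> = \<langle>x,y\<rangle>"
proof -
  obtain d where d: "d \<in> initial" "x - d \<in> ker H V" "V x = V d"
    using initial_component[OF x] .
  have c: "d \<in> hcarrier H" "y \<in> hcarrier H"
    using d y initial_subset by auto
  have "\<langle>y,x - d\<rangle> = 0"
    using y d by (auto simp: orth_def)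
  then have "\<langle>x - d,y\<rangle> = 0"
    using inner_sym_eq_0 x c by simp
  then show ?thesis
    using d V_inner_initial[OF d(1) y] x c by (simp add: inner_simps)
qed

section \<open>The spaces \<open>ran_tilde H V w\<close> and their intersection\<close>

lemma V_minus_scalar_bounded_below:
  assumes "x \<in> initial"
  shows "\<bar>1 - cmod w\<bar> * hnorm H x \<le> hnorm H (V x - hscale H w x)"
proof -
  have x: "x \<in> hcarrier H"
    using assms initial_subset by auto
  have "\<bar>1 - cmod w\<bar> * hnorm H x = \<bar>(1 - cmod w) * hnorm H x\<bar>"
    using x by (simp add: abs_mult)
  also have "\<dots> = \<bar>hnorm H (V x) - hnorm H (hscale H w x)\<bar>"
    using x V_isometric[OF assms] by (simp add: left_diff_distrib)
  also have "\<dots> \<le> hnorm H (V x - hscale H w x)"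
    using x by (intro hnorm_triangle_ineq2) auto
  finally show ?thesis .
qed

lemma ran_tilde_subset: "ran_tilde H V w \<subseteq> hcarrier H"
  using initial_subset by (auto simp: ran_tilde_def)

lemma ran_tilde_subspace: "vs.subspace (ran_tilde H V w)"
proof (rule vs.subspaceI)
  show "0 \<in> ran_tilde H V w"
    unfolding ran_tilde_def using vs.subspace_0[OF initial_subspace] by (auto intro!: image_eqI[of _ _ 0])
next
  fix x y
  assume "x \<in> ran_tilde H V w" "y \<in> ran_tilde H V w"
  then obtain a b where ab: "a \<in> initial" "b \<in> initial"
    and "x = V a - hscale H w a" "y = V b - hscale H w b"
    by (auto simp: ran_tilde_def)
  then have "x + y = V (a + b) - hscale H w (a + b)"
    using initial_carrier by (simp add: V_add vs.scale_right_distrib)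
  then show "x + y \<in> ran_tilde H V w"
    unfolding ran_tilde_def using vs.subspace_add[OF initial_subspace] ab by blast
next
  fix c x
  assume "x \<in> ran_tilde H V w"
  then obtain a where a: "a \<in> initial" and "x = V a - hscale H w a"
    by (auto simp: ran_tilde_def)
  then have "hscale H c x = V (hscale H c a) - hscale H w (hscale H c a)"
    using initial_carrier by (simp add: V_scale vs.scale_right_diff_distrib mult.commute)
  then show "hscale H c x \<in> ran_tilde H V w"
    unfolding ran_tilde_def using vs.subspace_scale[OF initial_subspace] a by blast
qed

text \<open>Off the circle \<open>V - w\<close> is bounded below on the initial space, by the
  reverse triangle inequality. Hence preimages of a convergent sequence form a Cauchy
  sequence.\<close>

lemma ran_tilde_closed_subspace:
  assumes w: "w \<in> off_circle"
  shows "closed_subspace H (ran_tilde H V w)"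
  unfolding closed_subspace_def closedin_sequentially
proof (intro conjI allI impI ran_tilde_subspace ran_tilde_subset)
  fix s x
  assume s: "range s \<subseteq> ran_tilde H V w \<and> tends s x"
  then have "\<forall>k. \<exists>a. a \<in> initial \<and> s k = V a - hscale H w a"
    by (auto simp: ran_tilde_def)
  then obtain a where a: "\<And>k. a k \<in> initial" "\<And>k. s k = V (a k) - hscale H w (a k)"
    by metis
  have ac: "a k \<in> hcarrier H" "s k \<in> hcarrier H" for k
    using a(1) s initial_carrier by (auto simp: tends_def)
  define q where "q = \<bar>1 - cmod w\<bar>"
  have q: "q > 0"
    using w by (auto simp: q_def)
  have le: "q * hnorm H (a m - a k) \<le> hnorm H (s m - x) + hnorm H (s k - x)" for m k
  proof -
    have "s m - s k = V (a m - a k) - hscale H w (a m - a k)"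
      unfolding a(2) using ac by (simp add: V_diff vs.scale_right_diff_distrib)
    then have "q * hnorm H (a m - a k) \<le> hnorm H (s m - s k)"
      unfolding q_def using V_minus_scalar_bounded_below[of "a m - a k"] vs.subspace_diff[OF initial_subspace a(1) a(1)]
      by metis
    also have "\<dots> \<le> hnorm H (s m - x) + hnorm H (s k - x)"
      using hnorm_triangle_diff[of "s m" x "s k"] hnorm_minus_commute[of x "s k"] ac s by (simp add: tends_def)
    finally show ?thesis .
  qed
  have "\<exists>y. tends a y"
  proof (rule Cauchy_tends)
    fix e :: real
    assume "e > 0"
    have "(\<lambda>k. hnorm H (s k - x)) \<longlonglongrightarrow> 0"
      using s by (simp add: tends_def)
    then have "\<forall>\<^sub>F k in sequentially. hnorm H (s k - x) < q * e / 2"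
      by (rule order_tendstoD) (use \<open>e > 0\<close> q in simp)
    then obtain N where N: "\<And>k. k \<ge> N \<Longrightarrow> hnorm H (s k - x) < q * e / 2"
      by (auto simp: eventually_sequentially)
    have "hnorm H (a m - a k) < e" if "m \<ge> N" "k \<ge> N" for m k
    proof -
      have "q * hnorm H (a m - a k) < q * e"
        using le[of m k] N[OF that(1)] N[OF that(2)] by linarith
      then show ?thesis
        using q by simp
    qed
    then show "\<exists>N. \<forall>m\<ge>N. \<forall>k\<ge>N. hnorm H (a m - a k) < e"
      by blast
  qed (use ac in auto)
  then obtain y where y: "tends a y"
    by blast
  have "tends s (V y - hscale H w y)"
    using tends_diff[OF V_tends[OF y] tends_scale[OF y, of w]] by (simp flip: a(2))
  then have "x = V y - hscale H w y"
    using s tends_unique by blast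
  moreover have "y \<in> initial"
    using a y by (intro initial_tends[of a]) auto
  ultimately show "x \<in> ran_tilde H V w"
    by (auto simp: ran_tilde_def)
qed

text \<open>Writing \<open>g - w f = (V - w) a\<close> with \<open>a\<close> in the initial space,
  the vectors \<open>a\<close> approach \<open>f\<close> as \<open>w\<close> grows, and the initial
  space is closed. The case \<open>g = 0\<close> concerns the unitary part, the general case the
  domain of the model shift.\<close>

lemma initial_if_ran_tilde:
  assumes f: "f \<in> hcarrier H" and g: "g \<in> hcarrier H"
    and ran: "\<And>w. w \<in> off_circle \<Longrightarrow> g - hscale H w f \<in> ran_tilde H V w"
  shows "f \<in> initial"
proof -
  \<comment> \<open>The shift by 2 keeps every point off the circle and makes the lower bound for
    \<open>V - w k\<close> equal to \<open>k + 1\<close>, which is positive from the start.\<close>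
  define w where "w k = complex_of_real (real k + 2)" for k
  have cw: "cmod (w k) = real k + 2" for k
    unfolding w_def by (simp add: norm_of_real del: of_real_add)
  then have w: "w k \<in> off_circle" for k
    by auto
  have "\<forall>k. \<exists>a. a \<in> initial \<and> g - hscale H (w k) f = V a - hscale H (w k) a"
    using ran[OF w] by (auto simp: ran_tilde_def)
  then obtain a where a: "\<And>k. a k \<in> initial"
    and eq: "\<And>k. g - hscale H (w k) f = V (a k) - hscale H (w k) (a k)"
    by metis
  have ac: "a k \<in> hcarrier H" for k
    using a initial_carrier by auto
  have an: "hnorm H (a k) \<le> hnorm H g + 2 * hnorm H f" for k
  proof -
    have "(real k + 1) * hnorm H (a k) \<le> hnorm H (g - hscale H (w k) f)"
      using V_minus_scalar_bounded_below[OF a, of "w k" k] by (simp add: eq cw)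
    also have "\<dots> \<le> hnorm H g + (real k + 2) * hnorm H f"
      using hnorm_triangle[of g "- hscale H (w k) f"] f g by (simp add: cw)
    also have "\<dots> \<le> (real k + 1) * (hnorm H g + 2 * hnorm H f)"
      using f g by (simp add: algebra_simps)
    finally show ?thesis
      by (simp add: mult_le_cancel_left)
  qed
  define C where "C = 2 * hnorm H g + 2 * hnorm H f"
  have bound: "norm (hnorm H (a k - f)) \<le> C * inverse (real (Suc k))" for k
  proof -
    \<comment> \<open>After rearrangement the right-hand side stays bounded, because
      \<open>V\<close> is isometric on \<open>a k\<close> and the \<open>a k\<close> are bounded. So
      \<open>a k - f\<close> is of order \<open>1 / w k\<close>.\<close>
    have "hscale H (w k) (a k - f) = V (a k) - g"
      using eq[of k] by (simp add: vs.scale_right_diff_distrib algebra_simps)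
    then have "(real k + 2) * hnorm H (a k - f) = hnorm H (V (a k) - g)"
      using hnorm_scale[of "a k - f" "w k"] ac f by (simp add: cw)
    also have "\<dots> \<le> hnorm H (a k) + hnorm H g"
      using hnorm_triangle[of "V (a k)" "- g"] ac g V_isometric[OF a] by simp
    also have "\<dots> \<le> C"
      using an[of k] by (simp add: C_def)
    finally have "(real k + 2) * hnorm H (a k - f) \<le> C" .
    moreover have "(real k + 1) * hnorm H (a k - f) \<le> (real k + 2) * hnorm H (a k - f)"
      using ac f by (intro mult_right_mono) auto
    ultimately have "(real k + 1) * hnorm H (a k - f) \<le> C"
      by (rule order_trans[rotated])
    then show ?thesis
      using ac f by (simp add: field_simps)
  qed
  have "(\<lambda>k. C * inverse (real (Suc k))) \<longlonglongrightarrow> C * 0"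
    by (intro tendsto_intros LIMSEQ_inverse_real_of_nat)
  then have "(\<lambda>k. C * inverse (real (Suc k))) \<longlonglongrightarrow> 0"
    by simp
  with bound have "(\<lambda>k. hnorm H (a k - f)) \<longlonglongrightarrow> 0"
    by (metis (no_types, lifting) Lim_null_comparison always_eventually)
  then have "tends a f"
    using ac f by (auto simp: tends_def)
  then show ?thesis
    using a by (intro initial_tends[of a]) auto
qed

text \<open>The intersection of the spaces \<open>ran_tilde H V w\<close> is the unitary part of \<open>V\<close>.\<close>

lemma inter_ran_tilde_reducing:
  defines "N \<equiv> {x. \<forall>w\<in>off_circle. x \<in> ran_tilde H V w}"
  shows "reducing H V N" "unitary_on H V N"
proof -
  have N: "N \<subseteq> ran_tilde H V w" if "w \<in> off_circle" for w
    using that by (auto simp: N_def)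
  have 0: "0 \<in> off_circle"
    by simp
  have Nc: "N \<subseteq> hcarrier H"
    using N[OF 0] ran_tilde_subset by auto
  have "\<exists>a\<in>initial. x = V a" if "x \<in> N" for x
    using N[OF 0] that by (auto simp: ran_tilde_def)
  then have pre: "\<exists>a\<in>initial. x = V a - hscale H w a" if "x \<in> N" "w \<in> off_circle" for x w
    using N[OF that(2)] that by (auto simp: ran_tilde_def)
  \<comment> \<open>This is \<open>initial_if_ran_tilde\<close> with \<open>g = 0\<close>, as
    \<open>ran_tilde H V w\<close> contains \<open>- w x\<close> along with
    \<open>x\<close>.\<close>
  have NI: "N \<subseteq> initial"
  proof
    fix x
    assume x: "x \<in> N"
    have "0 - hscale H w x \<in> ran_tilde H V w" if "w \<in> off_circle" for w
      using N[OF that] x vs.subspace_neg[OF ran_tilde_subspace] vs.subspace_scale[OF ran_tilde_subspace]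
      by auto
    then show "x \<in> initial"
      using x Nc by (intro initial_if_ran_tilde[of x 0]) auto
  qed
  have VN: "V x \<in> N" if x: "x \<in> N" for x
    unfolding N_def
  proof safe
    fix w :: complex
    assume "w \<notin> sphere 0 1"
    then have "x \<in> ran_tilde H V w"
      using N x by auto
    moreover have "V x - hscale H w x \<in> ran_tilde H V w"
      using x NI by (auto simp: ran_tilde_def)
    ultimately have "(V x - hscale H w x) + hscale H w x \<in> ran_tilde H V w"
      by (intro vs.subspace_add vs.subspace_scale ran_tilde_subspace)
    then show "V x \<in> ran_tilde H V w"
      by simp
  qed
  \<comment> \<open>Surjectivity of \<open>V\<close> on \<open>N\<close>. The point 0 supplies a
    preimage \<open>y\<close> in the initial space; it remains to show that \<open>y\<close> lies in
    every \<open>ran_tilde H V w\<close>.\<close>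
  have preN: "\<exists>y\<in>N. V y = x" if x: "x \<in> N" for x
  proof -
    obtain y where y: "y \<in> initial" "x = V y"
      using pre[OF x 0] by auto
    have yc: "y \<in> hcarrier H" "x \<in> hcarrier H"
      using y initial_carrier x Nc by auto
    have off: "y \<in> ran_tilde H V w" if w: "w \<in> off_circle" "w \<noteq> 0" for w
    proof -
      obtain a where a: "a \<in> initial" "x = V a - hscale H w a"
        using pre[OF x w(1)] by auto
      have ac: "a \<in> hcarrier H"
        using a initial_carrier by auto
      \<comment> \<open>Both vectors come from \<open>x\<close>, as
        \<open>V y = x = V a - w a\<close>. The factor \<open>w\<close> can then be divided
        out.\<close>
      have "V (a - y) - hscale H w (a - y) = hscale H w y"
        using a y ac yc by (simp add: V_diff vs.scale_right_diff_distrib algebra_simps)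
      then have "hscale H w y \<in> ran_tilde H V w"
        using vs.subspace_diff[OF initial_subspace a(1) y(1)] by (force simp: ran_tilde_def)
      then have "hscale H (inverse w) (hscale H w y) \<in> ran_tilde H V w"
        by (rule vs.subspace_scale[OF ran_tilde_subspace])
      then show ?thesis
        using w by simp
    qed
    have "y \<in> ran_tilde H V 0"
    proof -
      \<comment> \<open>At 0 there is no factor to divide out, so points \<open>w k\<close> tending
        to 0 are used. The identity \<open>V (a k - y) = w k a k\<close> shows both that
        \<open>a k\<close> tends to \<open>y\<close> and that \<open>a k\<close> lies in
        \<open>ran_tilde H V 0\<close>, which is closed. The factor 1/2 keeps the lower bound for
        \<open>V - w k\<close> at least 1/2.\<close>
      define w where "w k = complex_of_real (inverse (real (Suc k)) / 2)" for k
      have cw: "cmod (w k) = inverse (real (Suc k)) / 2" for k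
        unfolding w_def norm_of_real by simp
      have "inverse (real (Suc k)) \<le> 1" for k
        by (simp add: field_simps)
      then have cw2: "cmod (w k) \<le> 1/2" "w k \<noteq> 0" for k
        using cw[of k] by (auto simp: w_def simp del: of_real_divide of_real_inverse)
      have w: "w k \<in> off_circle" for k
        using cw2[of k] by auto
      have "\<forall>k. \<exists>a. a \<in> initial \<and> x = V a - hscale H (w k) a"
        using pre[OF x w] by blast
      then obtain a where a: "\<And>k. a k \<in> initial" "\<And>k. x = V (a k) - hscale H (w k) (a k)"
        by metis
      have ac: "a k \<in> hcarrier H" for k
        using a(1) initial_carrier by auto
      have an: "hnorm H (a k) \<le> 2 * hnorm H x" for k
      proof -
        have "1/2 * hnorm H (a k) \<le> \<bar>1 - cmod (w k)\<bar> * hnorm H (a k)"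
          using cw2[of k] ac by (intro mult_right_mono) auto
        also have "\<dots> \<le> hnorm H x"
          using V_minus_scalar_bounded_below[OF a(1), of "w k" k] a(2)[of k] by simp
        finally show ?thesis
          by simp
      qed
      have d: "V (a k - y) = hscale H (w k) (a k)" for k
        using a(2)[of k] y ac yc by (simp add: V_diff algebra_simps)
      have "norm (hnorm H (a k - y)) \<le> hnorm H x * inverse (real (Suc k))" for k
      proof -
        have "hnorm H (a k - y) = hnorm H (V (a k - y))"
          using V_isometric[OF vs.subspace_diff[OF initial_subspace a(1) y(1)]] by simp
        also have "\<dots> = inverse (real (Suc k)) / 2 * hnorm H (a k)"
          unfolding d using ac by (simp add: cw)
        also have "\<dots> \<le> inverse (real (Suc k)) / 2 * (2 * hnorm H x)"
          using an by (intro mult_left_mono) auto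
        finally show ?thesis
          using ac yc by (simp add: mult.commute)
      qed
      moreover have "(\<lambda>k. hnorm H x * inverse (real (Suc k))) \<longlonglongrightarrow> 0"
        using tendsto_mult[OF tendsto_const LIMSEQ_inverse_real_of_nat, of "hnorm H x"] by simp
      ultimately have "(\<lambda>k. hnorm H (a k - y)) \<longlonglongrightarrow> 0"
        by (metis (no_types, lifting) Lim_null_comparison always_eventually)
      then have t: "tends a y"
        using ac yc by (auto simp: tends_def)
      have "a k \<in> ran_tilde H V 0" for k
      proof -
        have "hscale H (inverse (w k)) (V (a k - y)) = a k"
          unfolding d using cw2(2)[of k] by simp
        moreover have "V (a k - y) \<in> ran_tilde H V 0"
          using vs.subspace_diff[OF initial_subspace a(1) y(1)] by (auto simp: ran_tilde_def)
        ultimately show ?thesis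
          using vs.subspace_scale[OF ran_tilde_subspace] by metis
      qed
      then show ?thesis
        using ran_tilde_closed_subspace[OF 0] t unfolding closed_subspace_def closedin_sequentially
        by blast
    qed
    with off have "y \<in> N"
      unfolding N_def by blast
    with y show ?thesis
      by auto
  qed
  show "unitary_on H V N"
    unfolding unitary_on_def using VN preN NI V_isometric by (auto simp: image_iff)
  have "closed_subspace H N"
    unfolding closed_subspace_def closedin_sequentially
  proof (intro conjI allI impI Nc)
    show "vs.subspace N"
      unfolding N_def using ran_tilde_subspace
      by (intro vs.subspaceI) (auto intro: vs.subspace_0 vs.subspace_add vs.subspace_scale)
    fix s x
    assume s: "range s \<subseteq> N \<and> tends s x"
    have "x \<in> ran_tilde H V w" if "w \<in> off_circle" for w
      using ran_tilde_closed_subspace[OF that] s N[OF that]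
      unfolding closed_subspace_def closedin_sequentially by blast
    then show "x \<in> N"
      by (auto simp: N_def)
  qed
  \<comment> \<open>Every \<open>x\<close> in \<open>N\<close> has the form \<open>V z\<close> with
    \<open>z\<close> in \<open>N\<close>, and \<open>V\<close> preserves the inner product of
    \<open>y\<close> with \<open>z\<close>.\<close>
  moreover have "V y \<in> orth H N" if y: "y \<in> orth H N" for y
    unfolding orth_def
  proof safe
    show "V y \<in> hcarrier H"
      using y by (simp add: orth_def)
    fix x
    assume "x \<in> N"
    then obtain z where z: "z \<in> N" "x = V z"
      using preN by auto
    then show "\<langle>V y,x\<rangle> = 0"
      using V_inner[of y z] y NI by (auto simp: orth_def)
  qed
  ultimately show "reducing H V N"
    unfolding reducing_def using VN by auto
qed

lemma inter_ran_tilde_trivial: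
  assumes "completely_non_unitary H V"
    and "\<And>w. w \<in> off_circle \<Longrightarrow> x \<in> ran_tilde H V w"
  shows "x = 0"
  using assms inter_ran_tilde_reducing unfolding completely_non_unitary_def by blast

end

section \<open>Abstract models\<close>

lemma complex_euclidean_simps [simp]:
  "hcarrier complex_euclidean = UNIV" "hscale complex_euclidean = (*s)"
  "hinner complex_euclidean v w = (\<Sum>i\<in>UNIV. v $ i * cnj (w $ i))"
  by (simp_all add: complex_euclidean_def)

lemma hnorm_complex_euclidean_axis [simp]:
  fixes i :: "'n::finite"
  shows "hnorm complex_euclidean (axis i 1) = 1"
proof -
  have "(axis i 1 :: complex ^ 'n) $ j * cnj ((axis i 1 :: complex ^ 'n) $ j) = (if j = i then 1 else 0)" for j
    by (simp add: axis_def)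
  then show ?thesis
    by (simp add: hnorm_def)
qed

lemma linear_functional_expansion:
  fixes L :: "complex ^ 'n \<Rightarrow> complex"
  assumes add: "\<And>v w. L (v + w) = L v + L w" and scale: "\<And>c v. L (c *s v) = c * L v"
  shows "L v = (\<Sum>i\<in>UNIV. v $ i * L (axis i 1))"
proof -
  have 0: "L 0 = 0"
    using scale[of 0 0] by simp
  have "L (\<Sum>i\<in>S. v $ i *s axis i 1) = (\<Sum>i\<in>S. v $ i * L (axis i 1))" if "finite S" for S
    using that by induction (simp_all add: 0 add scale)
  from this[of UNIV] show ?thesis
    by (simp add: basis_expansion)
qed

text \<open>The estimate has the shape of \<open>anti_analytic_off_circle\<close>. Since the
  complement of the circle is open, the derivative within it is the full derivative.\<close>

lemma has_field_derivativeI_off_circle: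
  assumes w: "w \<in> off_circle"
    and "\<And>e. e > 0 \<Longrightarrow> \<exists>d>0. \<forall>u\<in>off_circle. dist u w < d \<longrightarrow>
      cmod (f u - f w - (u - w) * D) \<le> e * dist u w"
  shows "(f has_field_derivative D) (at w)"
proof -
  have "(f has_field_derivative D) (at w within off_circle)"
    unfolding has_field_derivative_def has_derivative_within_alt
  proof (intro conjI allI impI bounded_linear_mult_right)
    fix e :: real
    assume "e > 0"
    from assms(2)[OF this] show "\<exists>d>0. \<forall>y\<in>off_circle. norm (y - w) < d \<longrightarrow>
        norm (f y - f w - D * (y - w)) \<le> e * norm (y - w)"
      by (simp add: dist_norm mult.commute)
  qed
  moreover have "open off_circle"
    by (simp add: open_Compl)
  ultimately show ?thesis
    using w at_within_open by metis
qed

text \<open>A matrix commutes with the scalar \<open>z\<close>. This is the source of the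
  intertwining relation for multipliers.\<close>

lemma mult_by_mult_z: "mult_by R (mult_z F) = mult_z (mult_by R F)"
  by (simp add: mult_by_def mult_z_def vector_scalar_commute)

locale model = partial_isometry_space H V
  for H :: "'a::ab_group_add hspace" and V +
  fixes \<Gamma> :: "complex \<Rightarrow> complex ^ 'n \<Rightarrow> 'a"
  assumes completely_non_unitary: "completely_non_unitary H V"
    and is_model: "is_model H V \<Gamma>"
begin

section \<open>Coordinates and zeros of the transforms\<close>

lemma \<Gamma>_carrier [simp]: "w \<in> off_circle \<Longrightarrow> \<Gamma> w v \<in> hcarrier H"
  and \<Gamma>_add: "w \<in> off_circle \<Longrightarrow> \<Gamma> w (v + v') = \<Gamma> w v + \<Gamma> w v'"
  and \<Gamma>_scale: "w \<in> off_circle \<Longrightarrow> \<Gamma> w (c *s v) = hscale H c (\<Gamma> w v)"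
  and \<Gamma>_inj: "w \<in> off_circle \<Longrightarrow> inj (\<Gamma> w)"
  and \<Gamma>_range: "w \<in> off_circle \<Longrightarrow> range (\<Gamma> w) = orth H (ran_tilde H V w)"
  using is_model unfolding is_model_def bounded_operator_def bij_betw_def by auto

lemma inner_\<Gamma>_left:
  assumes "w \<in> off_circle" "f \<in> hcarrier H"
  shows "\<langle>\<Gamma> w v,f\<rangle> = (\<Sum>i\<in>UNIV. v $ i * \<langle>\<Gamma> w (axis i 1),f\<rangle>)"
  using assms by (intro linear_functional_expansion) (simp_all add: \<Gamma>_add \<Gamma>_scale inner_simps)

lemma inner_\<Gamma>_right:
  assumes "w \<in> off_circle" "f \<in> hcarrier H"
  shows "\<langle>f,\<Gamma> w v\<rangle> = (\<Sum>i\<in>UNIV. cnj (v $ i) * \<langle>f,\<Gamma> w (axis i 1)\<rangle>)"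
proof -
  have c: "\<langle>f,\<Gamma> w u\<rangle> = cnj \<langle>\<Gamma> w u,f\<rangle>" for u
    using assms by (intro inner_commute) auto
  show ?thesis
    unfolding c inner_\<Gamma>_left[OF assms, of v] by simp
qed

text \<open>Resolves the definite description in \<open>adj\<close>: testing on the axis vectors
  determines the adjoint. Afterwards transforms off the circle are handled through these scalar
  inner products.\<close>

lemma hat_nth:
  assumes w: "w \<in> off_circle" and f: "f \<in> hcarrier H"
  shows "hat H \<Gamma> f w $ i = \<langle>f,\<Gamma> w (axis i 1)\<rangle>"
proof -
  have c: "\<langle>\<Gamma> w v,f\<rangle> = cnj \<langle>f,\<Gamma> w v\<rangle>" for v
    using w f by (intro inner_commute) auto
  have "adj complex_euclidean H (\<Gamma> w) f = (\<chi> i. \<langle>f,\<Gamma> w (axis i 1)\<rangle>)"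
    unfolding adj_def
  proof (rule the_equality)
    show "(\<chi> i. \<langle>f,\<Gamma> w (axis i 1)\<rangle>) \<in> hcarrier complex_euclidean \<and>
        (\<forall>v\<in>hcarrier complex_euclidean.
          hinner complex_euclidean v (\<chi> i. \<langle>f,\<Gamma> w (axis i 1)\<rangle>) = \<langle>\<Gamma> w v,f\<rangle>)"
      using inner_\<Gamma>_left[OF w f, symmetric] by (simp flip: c)
    fix x
    assume x: "x \<in> hcarrier complex_euclidean \<and>
        (\<forall>v\<in>hcarrier complex_euclidean. hinner complex_euclidean v x = \<langle>\<Gamma> w v,f\<rangle>)"
    show "x = (\<chi> i. \<langle>f,\<Gamma> w (axis i 1)\<rangle>)"
    proof (simp add: vec_eq_iff, rule allI)
      fix i
      have "hinner complex_euclidean (axis i 1) x = \<langle>\<Gamma> w (axis i 1),f\<rangle>"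
        using x by simp
      moreover have "hinner complex_euclidean (axis i 1) x = (\<Sum>j\<in>UNIV. if j = i then cnj (x $ j) else 0)"
        by (simp add: axis_def if_distrib if_distribR cong: if_cong)
      ultimately have "cnj (x $ i) = \<langle>\<Gamma> w (axis i 1),f\<rangle>"
        by simp
      then show "x $ i = \<langle>f,\<Gamma> w (axis i 1)\<rangle>"
        using c[of "axis i 1"] by simp
    qed
  qed
  then show ?thesis
    using w by (simp add: hat_def)
qed

lemma hat_circle: "w \<notin> off_circle \<Longrightarrow> hat H \<Gamma> f w = 0"
  by (simp add: hat_def)

lemma hat_eqI:
  assumes f: "f \<in> hcarrier H"
    and "\<And>w i. w \<in> off_circle \<Longrightarrow> F w $ i = \<langle>f,\<Gamma> w (axis i 1)\<rangle>"
    and "\<And>w. w \<notin> off_circle \<Longrightarrow> F w = 0"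
  shows "F = hat H \<Gamma> f"
proof
  fix w
  show "F w = hat H \<Gamma> f w"
    by (cases "w \<in> off_circle") (use assms hat_circle in \<open>simp_all add: vec_eq_iff hat_nth del: Compl_iff\<close>)
qed

lemma hat_add: "f \<in> hcarrier H \<Longrightarrow> g \<in> hcarrier H \<Longrightarrow> hat H \<Gamma> f + hat H \<Gamma> g = hat H \<Gamma> (f + g)"
  by (rule hat_eqI) (simp_all add: hat_nth hat_circle inner_simps del: Compl_iff)

lemma hat_diff: "f \<in> hcarrier H \<Longrightarrow> g \<in> hcarrier H \<Longrightarrow> hat H \<Gamma> f - hat H \<Gamma> g = hat H \<Gamma> (f - g)"
  by (rule hat_eqI) (simp_all add: hat_nth hat_circle inner_simps del: Compl_iff)

lemma hat_scale: "f \<in> hcarrier H \<Longrightarrow> (\<lambda>w. c *s hat H \<Gamma> f w) = hat H \<Gamma> (hscale H c f)"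
  by (rule hat_eqI) (simp_all add: hat_nth hat_circle inner_simps del: Compl_iff)

lemma hat_zero [simp]: "hat H \<Gamma> 0 = 0"
  by (rule hat_eqI[symmetric]) simp_all

text \<open>The adjoint of \<open>\<Gamma> w\<close> vanishes exactly on the orthogonal complement
  of its range, and this is \<open>ran_tilde H V w\<close> because that space is closed. So the
  value of a transform at \<open>w\<close> determines the vector modulo
  \<open>ran_tilde H V w\<close>.\<close>

lemma hat_eq_0_iff:
  assumes w: "w \<in> off_circle" and f: "f \<in> hcarrier H"
  shows "hat H \<Gamma> f w = 0 \<longleftrightarrow> f \<in> ran_tilde H V w"
proof -
  have "hat H \<Gamma> f w = 0 \<longleftrightarrow> (\<forall>i. \<langle>f,\<Gamma> w (axis i 1)\<rangle> = 0)"
    using hat_nth[OF w f] by (simp add: vec_eq_iff)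
  also have "\<dots> \<longleftrightarrow> (\<forall>v. \<langle>f,\<Gamma> w v\<rangle> = 0)"
    by (metis (no_types, lifting) inner_\<Gamma>_right[OF w f] mult_zero_right sum.neutral)
  also have "\<dots> \<longleftrightarrow> f \<in> orth H (range (\<Gamma> w))"
    using f by (auto simp: orth_def)
  finally show ?thesis
    using \<Gamma>_range[OF w] orth_orth_closed_subspace[OF ran_tilde_closed_subspace[OF w]] by simp
qed

lemma hat_eq_0: "f \<in> hcarrier H \<Longrightarrow> hat H \<Gamma> f = 0 \<Longrightarrow> f = 0"
  using inter_ran_tilde_trivial[OF completely_non_unitary, of f] hat_eq_0_iff[of _ f] by simp

lemma hat_inj: "inj_on (hat H \<Gamma>) (hcarrier H)"
proof (rule inj_onI)
  fix f g
  assume "f \<in> hcarrier H" "g \<in> hcarrier H" "hat H \<Gamma> f = hat H \<Gamma> g"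
  then show "f = g"
    using hat_eq_0[of "f - g"] hat_diff[of f g] by simp
qed

lemma hat_eq_iff [simp]: "f \<in> hcarrier H \<Longrightarrow> g \<in> hcarrier H \<Longrightarrow> hat H \<Gamma> f = hat H \<Gamma> g \<longleftrightarrow> f = g"
  using hat_inj by (auto dest: inj_onD)

section \<open>The model space and its shift\<close>

abbreviation "K \<equiv> model_space H \<Gamma>"

lemma model_carrier [simp]: "hcarrier K = hat H \<Gamma> ` hcarrier H"
  and model_scale [simp]: "hscale K c F = (\<lambda>w. c *s F w)"
  by (simp_all add: model_space_def)

lemma inv_hat [simp]: "f \<in> hcarrier H \<Longrightarrow> inv_into (hcarrier H) (hat H \<Gamma>) (hat H \<Gamma> f) = f"
  by (rule inv_into_f_f[OF hat_inj])

lemma model_inner [simp]: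
  "f \<in> hcarrier H \<Longrightarrow> g \<in> hcarrier H \<Longrightarrow> hinner K (hat H \<Gamma> f) (hat H \<Gamma> g) = \<langle>f,g\<rangle>"
  by (simp add: model_space_def)

lemma model_hnorm [simp]: "f \<in> hcarrier H \<Longrightarrow> hnorm K (hat H \<Gamma> f) = hnorm H f"
  by (simp add: hnorm_def)

lemma model_orth: "S \<subseteq> hcarrier H \<Longrightarrow> orth K (hat H \<Gamma> ` S) = hat H \<Gamma> ` orth H S"
  by (auto simp: orth_def subset_iff)

text \<open>The vector \<open>V f - w f\<close> is orthogonal to the range of
  \<open>\<Gamma> w\<close>, so the transforms of \<open>V f\<close> and \<open>w f\<close> agree at
  \<open>w\<close>.\<close>

lemma mult_z_hat:
  assumes f: "f \<in> initial"
  shows "mult_z (hat H \<Gamma> f) = hat H \<Gamma> (V f)"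
proof (rule hat_eqI)
  have fc: "f \<in> hcarrier H"
    using f by (rule initial_carrier)
  then show "V f \<in> hcarrier H"
    by simp
  fix w i
  assume w: "w \<in> off_circle"
  have "V f - hscale H w f \<in> ran_tilde H V w"
    using f by (auto simp: ran_tilde_def)
  then have "\<langle>\<Gamma> w (axis i 1),V f - hscale H w f\<rangle> = 0"
    using \<Gamma>_range[OF w] by (auto simp: orth_def set_eq_iff)
  then have "\<langle>V f - hscale H w f,\<Gamma> w (axis i 1)\<rangle> = 0"
    using inner_sym_eq_0 fc w by simp
  then show "mult_z (hat H \<Gamma> f) w $ i = \<langle>V f,\<Gamma> w (axis i 1)\<rangle>"
    using fc w by (simp add: mult_z_def hat_nth inner_simps del: Compl_iff)
qed (simp add: mult_z_def hat_circle del: Compl_iff)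

text \<open>Determines the domain of the model shift: if \<open>z\<close> times the transform of
  \<open>f\<close> is the transform of \<open>g\<close>, then the transform of
  \<open>g - w f\<close> vanishes at \<open>w\<close>, for each \<open>w\<close>.\<close>

lemma mult_z_hat_in_model:
  assumes f: "f \<in> hcarrier H"
  shows "mult_z (hat H \<Gamma> f) \<in> hcarrier K \<longleftrightarrow> f \<in> initial"
proof
  assume "mult_z (hat H \<Gamma> f) \<in> hcarrier K"
  then obtain g where g: "g \<in> hcarrier H" "mult_z (hat H \<Gamma> f) = hat H \<Gamma> g"
    by auto
  have "g - hscale H w f \<in> ran_tilde H V w" if w: "w \<in> off_circle" for w
  proof -
    have "hat H \<Gamma> (g - hscale H w f) w = 0"
      using fun_cong[OF g(2), of w] f g(1)
      by (simp add: mult_z_def flip: hat_diff hat_scale)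
    then show ?thesis
      using hat_eq_0_iff[OF w, of "g - hscale H w f"] f g by simp
  qed
  then show "f \<in> initial"
    using initial_if_ran_tilde[OF f g(1)] by blast
qed (use mult_z_hat initial_carrier in auto)

text \<open>The transform carries the initial space to the domain of multiplication by
  \<open>z\<close>, so the projection in \<open>model_shift\<close> picks the component
  \<open>d\<close> of \<open>f\<close> in the initial space, and \<open>V d = V f\<close>.\<close>

lemma model_shift_hat:
  assumes f: "f \<in> hcarrier H"
  shows "model_shift K (hat H \<Gamma> f) = hat H \<Gamma> (V f)"
proof -
  obtain d where d: "d \<in> initial" "f - d \<in> ker H V" "V f = V d"
    using initial_component[OF f] .
  have dc: "d \<in> hcarrier H"
    using d(1) by (rule initial_carrier)
  have domain: "{G \<in> hcarrier K. mult_z G \<in> hcarrier K} = hat H \<Gamma> ` initial"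
    using mult_z_hat_in_model initial_carrier by auto
  have orth: "orth K (hat H \<Gamma> ` initial) = hat H \<Gamma> ` ker H V"
    using model_orth[OF initial_subset] orth_orth_closed_subspace[OF ker_closed_subspace] by simp
  have "hproj K (hat H \<Gamma> ` initial) (hat H \<Gamma> f) = hat H \<Gamma> d"
    unfolding hproj_def orth
  proof (rule the_equality)
    show "hat H \<Gamma> d \<in> hat H \<Gamma> ` initial \<and> hat H \<Gamma> f - hat H \<Gamma> d \<in> hat H \<Gamma> ` ker H V"
      using d f dc by (simp add: hat_diff)
    fix P
    assume "P \<in> hat H \<Gamma> ` initial \<and> hat H \<Gamma> f - P \<in> hat H \<Gamma> ` ker H V"
    then obtain p k where p: "p \<in> initial" "k \<in> ker H V" "P = hat H \<Gamma> p" "hat H \<Gamma> f - hat H \<Gamma> p = hat H \<Gamma> k"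
      by auto
    have pc: "p \<in> hcarrier H" "k \<in> hcarrier H"
      using p initial_carrier ker_subset by auto
    then have "f - p \<in> ker H V"
      using p(2,4) f by (simp add: hat_diff)
    then have "V d = V p"
      using d(3) f pc by (simp add: ker_def V_diff)
    then have "d - p \<in> ker H V"
      using dc pc by (simp add: ker_def V_diff)
    moreover have "d - p \<in> initial"
      by (rule vs.subspace_diff[OF initial_subspace d(1) p(1)])
    ultimately have "d - p = 0"
      by (rule orth_inter_self)
    then show "P = hat H \<Gamma> d"
      using p by simp
  qed
  then show ?thesis
    unfolding model_shift_def domain using mult_z_hat[OF d(1)] d(3) by simp
qed

lemma model_initial: "orth K (ker K (model_shift K)) = hat H \<Gamma> ` initial"
proof -
  have "ker K (model_shift K) = hat H \<Gamma> ` ker H V"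
    using hat_eq_0 by (auto simp: ker_def model_shift_hat)
  then show ?thesis
    using model_orth[OF ker_subset] by simp
qed

text \<open>The inner product is conjugate-linear in its second argument, which turns the factor
  \<open>cnj (u - w)\<close> into \<open>u - w\<close>. The derivative is therefore the inner
  product of \<open>f\<close> with \<open>D v\<close>.\<close>

lemma hat_differentiable:
  assumes f: "f \<in> hcarrier H" and w: "w \<in> off_circle"
  shows "(\<lambda>u. hat H \<Gamma> f u $ i) field_differentiable at w"
proof -
  define v where "v = (axis i 1 :: complex ^ 'n)"
  obtain D where D: "bounded_operator complex_euclidean H D"
    and lim: "\<And>e. e > 0 \<Longrightarrow> \<exists>d>0. \<forall>u\<in>off_circle. dist u w < d \<longrightarrow>
      (\<forall>v. hnorm H (\<Gamma> u v - \<Gamma> w v - hscale H (cnj (u - w)) (D v))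
        \<le> e * dist u w * hnorm complex_euclidean v)"
    using is_model w unfolding is_model_def anti_analytic_off_circle_def by blast
  have Dc: "D v \<in> hcarrier H"
    using D by (simp add: bounded_operator_def)
  have "((\<lambda>u. hat H \<Gamma> f u $ i) has_field_derivative \<langle>f,D v\<rangle>) (at w)"
  proof (rule has_field_derivativeI_off_circle[OF w])
    fix e :: real
    assume e: "e > 0"
    \<comment> \<open>The added 1 keeps \<open>C\<close> positive when \<open>f = 0\<close>.\<close>
    define C where "C = hnorm H f + 1"
    have C: "C > 0"
      using hnorm_nonneg[OF f] by (simp add: C_def)
    then obtain d where d: "d > 0" "\<And>u. u \<in> off_circle \<Longrightarrow> dist u w < d \<Longrightarrow>
        hnorm H (\<Gamma> u v - \<Gamma> w v - hscale H (cnj (u - w)) (D v)) \<le> e / C * dist u w"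
      using lim[of "e / C"] e unfolding v_def by (metis divide_pos_pos hnorm_complex_euclidean_axis mult.right_neutral)
    have "cmod (hat H \<Gamma> f u $ i - hat H \<Gamma> f w $ i - (u - w) * \<langle>f,D v\<rangle>) \<le> e * dist u w"
      if u: "u \<in> off_circle" "dist u w < d" for u
    proof -
      have "hat H \<Gamma> f u $ i - hat H \<Gamma> f w $ i - (u - w) * \<langle>f,D v\<rangle>
          = \<langle>f,\<Gamma> u v - \<Gamma> w v - hscale H (cnj (u - w)) (D v)\<rangle>"
        using u w f Dc by (simp add: hat_nth v_def inner_simps del: Compl_iff)
      also have "cmod \<dots> \<le> hnorm H f * hnorm H (\<Gamma> u v - \<Gamma> w v - hscale H (cnj (u - w)) (D v))"
        using u w f Dc by (intro Cauchy_Schwarz) (simp_all del: Compl_iff)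
      also have "\<dots> \<le> C * (e / C * dist u w)"
        using d(2)[OF u] u w f Dc C by (intro mult_mono) (simp_all add: C_def del: Compl_iff)
      finally show ?thesis
        using C by simp
    qed
    with d(1) show "\<exists>d>0. \<forall>u\<in>off_circle. dist u w < d \<longrightarrow>
        cmod (hat H \<Gamma> f u $ i - hat H \<Gamma> f w $ i - (u - w) * \<langle>f,D v\<rangle>) \<le> e * dist u w"
      by blast
  qed
  then show ?thesis
    by (auto simp: field_differentiable_def)
qed

lemma hat_holomorphic: "f \<in> hcarrier H \<Longrightarrow> (\<lambda>w. hat H \<Gamma> f w $ i) holomorphic_on off_circle"
  unfolding holomorphic_on_def using hat_differentiable field_differentiable_at_within by blast

text \<open>The matrix of the adjoint of \<open>\<Gamma> z\<close> composed with
  \<open>\<Gamma> w\<close>, that is, the reproducing kernel of the model space. For fixed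
  \<open>w\<close> its entries are transforms, hence analytic in \<open>z\<close>.\<close>

definition gram :: "complex \<Rightarrow> complex \<Rightarrow> complex ^ 'n ^ 'n" where
  "gram w z = (\<chi> i j. hat H \<Gamma> (\<Gamma> w (axis j 1)) z $ i)"

lemma gram_mult:
  assumes w: "w \<in> off_circle" and z: "z \<in> off_circle"
  shows "gram w z *v c = hat H \<Gamma> (\<Gamma> w c) z"
  using inner_\<Gamma>_left[OF w \<Gamma>_carrier[OF z], of c]
  by (simp add: vec_eq_iff matrix_vector_mult_def gram_def hat_nth w z mult.commute del: Compl_iff)

text \<open>If \<open>c\<close> is in the kernel, then \<open>\<Gamma> w c\<close> lies both in
  \<open>ran_tilde H V w\<close> and in its orthogonal complement, and \<open>\<Gamma> w\<close> is
  injective.\<close>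

lemma gram_invertible:
  assumes w: "w \<in> off_circle"
  shows "invertible (gram w w)"
proof -
  have "c = 0" if "gram w w *v c = 0" for c
  proof -
    have "\<Gamma> w c \<in> ran_tilde H V w"
      using that gram_mult[OF w w] hat_eq_0_iff[OF w \<Gamma>_carrier[OF w]] by simp
    moreover have "\<Gamma> w c \<in> orth H (ran_tilde H V w)"
      using \<Gamma>_range[OF w] by auto
    ultimately have "\<Gamma> w c = 0"
      by (rule orth_inter_self)
    also have "0 = \<Gamma> w 0"
      using \<Gamma>_scale[OF w, of 0 0] by simp
    finally show ?thesis
      using \<Gamma>_inj[OF w] by (simp add: inj_eq)
  qed
  then have "inj ((*v) (gram w w))"
    by (intro injI) (metis eq_iff_diff_eq_0 matrix_vector_mult_diff_distrib)
  then show ?thesis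
    using matrix_left_invertible_injective invertible_left_inverse by blast
qed

lemma hat_surj:
  assumes w: "w \<in> off_circle"
  obtains c where "gram w w *v c = v"
  using gram_invertible[OF w] unfolding invertible_def
  by (metis matrix_vector_mul_assoc matrix_vector_mul_lid)

end

section \<open>Multipliers\<close>

text \<open>Row \<open>i\<close> of \<open>R\<close> solves the linear system with matrix
  \<open>transpose G\<close> and right-hand side row \<open>i\<close> of \<open>M\<close>, so this
  is Cramer's rule. The quotient of determinants makes analyticity of the entries of
  \<open>R\<close> visible.\<close>

lemma cramer_matrix:
  fixes R G M :: "'a::field ^ 'n ^ 'n"
  assumes RG: "R ** G = M" and G: "det G \<noteq> 0"
  shows "R $ i $ k = det (\<chi> l j. if j = k then M $ i $ l else G $ j $ l) / det G"
proof -
  have "(\<chi> l j. if j = k then (transpose G *v R $ i) $ l else transpose G $ l $ j)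
      = (\<chi> l j. if j = k then M $ i $ l else G $ j $ l)"
    using RG by (auto simp: vec_eq_iff matrix_matrix_mult_def matrix_vector_mult_def transpose_def mult.commute)
  with cramer_lemma[of k "transpose G" "R $ i"] G show ?thesis
    by (simp add: field_simps)
qed

lemma holomorphic_on_det:
  fixes F :: "complex \<Rightarrow> complex ^ 'n ^ 'n"
  assumes "\<And>i j. (\<lambda>z. F z $ i $ j) holomorphic_on S"
  shows "(\<lambda>z. det (F z)) holomorphic_on S"
  unfolding det_def by (intro holomorphic_intros assms)

lemma modelI:
  fixes \<Gamma> :: "complex \<Rightarrow> complex ^ 'n \<Rightarrow> 'a::ab_group_add"
  assumes "separable_hilbert_space H" "V \<in> cnu_partial_isometries CARD('n) H" "is_model H V \<Gamma>"
  shows "model H V \<Gamma>"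
  using assms
  by (auto simp: model_def model_axioms_def partial_isometry_space_def partial_isometry_space_axioms_def
    hilbert_space_def hilbert_space_axioms_def separable_hilbert_space_def
    separable_hilbert_space_axioms_def cnu_partial_isometries_def)

locale model_pair = A: model HA A \<Gamma>A + B: model HB B \<Gamma>B
  for HA :: "'a::ab_group_add hspace" and HB :: "'b::ab_group_add hspace"
    and A :: "'a \<Rightarrow> 'a" and B :: "'b \<Rightarrow> 'b"
    and \<Gamma>A :: "complex \<Rightarrow> complex ^ 'n \<Rightarrow> 'a" and \<Gamma>B :: "complex \<Rightarrow> complex ^ 'n \<Rightarrow> 'b"
begin

section \<open>Transport of the order between operators and their model shifts\<close>

lemma quasi_le_model_if_quasi_le:
  assumes "quasi_le HA A HB B"
  shows "quasi_le A.K (model_shift A.K) B.K (model_shift B.K)"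
proof -
  obtain X where X: "bounded_operator HA HB X" "inj_on X (hcarrier HA)"
    and XD: "\<And>x. x \<in> A.initial \<Longrightarrow> X x \<in> B.initial"
    and XA: "\<And>x. x \<in> A.initial \<Longrightarrow> X (A x) = B (X x)"
    using assms unfolding quasi_le_def by blast
  then obtain C where Xc [simp]: "\<And>x. x \<in> hcarrier HA \<Longrightarrow> X x \<in> hcarrier HB"
    and Xadd: "\<And>x y. x \<in> hcarrier HA \<Longrightarrow> y \<in> hcarrier HA \<Longrightarrow> X (x + y) = X x + X y"
    and Xscale: "\<And>c x. x \<in> hcarrier HA \<Longrightarrow> X (hscale HA c x) = hscale HB c (X x)"
    and C: "\<And>x. x \<in> hcarrier HA \<Longrightarrow> hnorm HB (X x) \<le> C * hnorm HA x"
    unfolding bounded_operator_def by blast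
  \<comment> \<open>The conjugate of \<open>X\<close> by the two transforms, which are unitary maps
    onto the model spaces.\<close>
  define Y where "Y F = hat HB \<Gamma>B (X (inv_into (hcarrier HA) (hat HA \<Gamma>A) F))" for F
  have Y: "Y (hat HA \<Gamma>A f) = hat HB \<Gamma>B (X f)" if "f \<in> hcarrier HA" for f
    using that by (simp add: Y_def)
  have "bounded_operator A.K B.K Y"
    unfolding bounded_operator_def
    using C by (auto simp: Y A.hat_add A.hat_scale B.hat_add B.hat_scale Xadd Xscale)
  moreover have "inj_on Y (hcarrier A.K)"
    using X(2) by (auto simp: inj_on_def Y)
  ultimately show ?thesis
    unfolding quasi_le_def A.model_initial B.model_initial using XD XA A.initial_carrier B.initial_carrier
    by (intro exI[of _ Y]) (auto simp: Y A.model_shift_hat B.model_shift_hat)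
qed

lemma quasi_le_if_quasi_le_model:
  assumes "quasi_le A.K (model_shift A.K) B.K (model_shift B.K)"
  shows "quasi_le HA A HB B"
proof -
  obtain Y where Y: "bounded_operator A.K B.K Y" "inj_on Y (hcarrier A.K)"
    and YD': "Y ` hat HA \<Gamma>A ` A.initial \<subseteq> hat HB \<Gamma>B ` B.initial"
    and YA': "\<forall>F\<in>hat HA \<Gamma>A ` A.initial. Y (model_shift A.K F) = model_shift B.K (Y F)"
    using assms unfolding quasi_le_def A.model_initial B.model_initial by (elim exE conjE)
  have YD: "Y (hat HA \<Gamma>A x) \<in> hat HB \<Gamma>B ` B.initial" if "x \<in> A.initial" for x
    using YD' that by (simp add: image_subset_iff)
  have YA: "Y (model_shift A.K (hat HA \<Gamma>A x)) = model_shift B.K (Y (hat HA \<Gamma>A x))"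
    if "x \<in> A.initial" for x
    using YA' that by simp
  from Y(1) obtain C where Yc: "\<And>x. x \<in> hcarrier HA \<Longrightarrow> Y (hat HA \<Gamma>A x) \<in> hat HB \<Gamma>B ` hcarrier HB"
    and Yadd: "\<And>x y. x \<in> hcarrier HA \<Longrightarrow> y \<in> hcarrier HA \<Longrightarrow>
      Y (hat HA \<Gamma>A x + hat HA \<Gamma>A y) = Y (hat HA \<Gamma>A x) + Y (hat HA \<Gamma>A y)"
    and Yscale: "\<And>c x. x \<in> hcarrier HA \<Longrightarrow>
      Y (\<lambda>w. c *s hat HA \<Gamma>A x w) = (\<lambda>w. c *s Y (hat HA \<Gamma>A x) w)"
    and C: "\<And>x. x \<in> hcarrier HA \<Longrightarrow> hnorm B.K (Y (hat HA \<Gamma>A x)) \<le> C * hnorm HA x"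
    unfolding bounded_operator_def
    by (simp add: ball_simps) (metis A.model_hnorm)
  \<comment> \<open>Conjugation in the opposite direction. Identities for \<open>X\<close> are
    verified after applying the injective transform into the second model.\<close>
  define X where "X f = inv_into (hcarrier HB) (hat HB \<Gamma>B) (Y (hat HA \<Gamma>A f))" for f
  have Xc [simp]: "X f \<in> hcarrier HB" and X: "hat HB \<Gamma>B (X f) = Y (hat HA \<Gamma>A f)"
    if "f \<in> hcarrier HA" for f
    using Yc[OF that] unfolding X_def by (auto intro: inv_into_into f_inv_into_f)
  have add: "X (x + y) = X x + X y" if "x \<in> hcarrier HA" "y \<in> hcarrier HA" for x y
  proof -
    have "hat HB \<Gamma>B (X (x + y)) = hat HB \<Gamma>B (X x + X y)"
      using that Yadd by (simp add: X flip: A.hat_add B.hat_add)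
    then show ?thesis
      using that by simp
  qed
  have scale: "X (hscale HA c x) = hscale HB c (X x)" if "x \<in> hcarrier HA" for c x
  proof -
    have "hat HB \<Gamma>B (X (hscale HA c x)) = hat HB \<Gamma>B (hscale HB c (X x))"
      using that Yscale by (simp add: X flip: A.hat_scale B.hat_scale)
    then show ?thesis
      using that by simp
  qed
  have "hnorm HB (X x) \<le> C * hnorm HA x" if "x \<in> hcarrier HA" for x
    using C[OF that] that B.model_hnorm[of "X x"] by (simp add: X)
  then have "bounded_operator HA HB X"
    unfolding bounded_operator_def using add scale by auto
  moreover have "inj_on X (hcarrier HA)"
    using Y(2) X by (simp add: inj_on_def) (metis A.hat_eq_iff)
  moreover have "X x \<in> B.initial" if "x \<in> A.initial" for x
    using YD[OF that] X[of x] that A.initial_carrier B.initial_carrier by (auto simp: image_iff)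
  moreover have "X (A x) = B (X x)" if x: "x \<in> A.initial" for x
  proof -
    have xc: "x \<in> hcarrier HA"
      using x by (rule A.initial_carrier)
    then have "hat HB \<Gamma>B (X (A x)) = hat HB \<Gamma>B (B (X x))"
      using YA[OF x] by (simp add: X A.model_shift_hat flip: B.model_shift_hat)
    then show ?thesis
      using xc by simp
  qed
  ultimately show ?thesis
    unfolding quasi_le_def by blast
qed

section \<open>Intertwiners and multipliers\<close>

lemma multiplier_if_quasi_le:
  assumes "quasi_le HA A HB B"
  obtains R where "is_multiplier A.K B.K R" "inj_on (mult_by R) (hcarrier A.K)"
proof -
  obtain X where X: "bounded_operator HA HB X" "inj_on X (hcarrier HA)"
    and XD: "\<And>x. x \<in> A.initial \<Longrightarrow> X x \<in> B.initial"
    and XA: "\<And>x. x \<in> A.initial \<Longrightarrow> X (A x) = B (X x)"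
    using assms unfolding quasi_le_def by blast
  then have Xc [simp]: "\<And>x. x \<in> hcarrier HA \<Longrightarrow> X x \<in> hcarrier HB"
    and Xadd: "\<And>x y. x \<in> hcarrier HA \<Longrightarrow> y \<in> hcarrier HA \<Longrightarrow> X (x + y) = X x + X y"
    and Xscale: "\<And>c x. x \<in> hcarrier HA \<Longrightarrow> X (hscale HA c x) = hscale HB c (X x)"
    unfolding bounded_operator_def by blast+
  have Xdiff: "X (x - y) = X x - X y" if "x \<in> hcarrier HA" "y \<in> hcarrier HA" for x y
    using Xadd[of "x - y" y] that by (simp add: algebra_simps)
  have fibre: "hat HB \<Gamma>B (X f) z = hat HB \<Gamma>B (X g) z"
    if f: "f \<in> hcarrier HA" and g: "g \<in> hcarrier HA" and z: "z \<in> off_circle"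
      and eq: "hat HA \<Gamma>A f z = hat HA \<Gamma>A g z" for f g z
  proof -
    have "f - g \<in> ran_tilde HA A z"
      using A.hat_eq_0_iff[OF z, of "f - g"] f g eq by (simp flip: A.hat_diff)
    then obtain a where a: "a \<in> A.initial" "f - g = A a - hscale HA z a"
      by (auto simp: ran_tilde_def)
    then have "X f - X g = B (X a) - hscale HB z (X a)"
      using Xdiff[of "A a" "hscale HA z a"] Xdiff[of f g] f g A.initial_carrier by (simp add: XA Xscale)
    then have "X f - X g \<in> ran_tilde HB B z"
      using XD a by (auto simp: ran_tilde_def)
    then show ?thesis
      using B.hat_eq_0_iff[OF z, of "X f - X g"] f g by (simp flip: B.hat_diff)
  qed
  \<comment> \<open>The counterpart of \<open>A.gram w z\<close>, with \<open>X\<close> applied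
    before the transform is taken in the second model.\<close>
  define M where "M w z = (\<chi> i j. hat HB \<Gamma>B (X (\<Gamma>A w (axis j 1))) z $ i)" for w z
  have M: "M w z *v c = hat HB \<Gamma>B (X (\<Gamma>A w c)) z"
    if w: "w \<in> off_circle" and z: "z \<in> off_circle" for w z c
  proof -
    have "hat HB \<Gamma>B (X (\<Gamma>A w c)) z $ i = (\<Sum>j\<in>UNIV. c $ j * hat HB \<Gamma>B (X (\<Gamma>A w (axis j 1))) z $ i)" for i
      using w by (intro linear_functional_expansion[where L = "\<lambda>c. hat HB \<Gamma>B (X (\<Gamma>A w c)) z $ i"])
        (simp_all add: A.\<Gamma>_add A.\<Gamma>_scale Xadd Xscale flip: B.hat_add B.hat_scale del: Compl_iff)
    then show ?thesis
      by (simp add: vec_eq_iff M_def matrix_vector_mult_def mult.commute)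
  qed
  \<comment> \<open>Every vector is the value at \<open>z\<close> of the transform of some
    \<open>\<Gamma>A z c\<close>, and \<open>X\<close> turns this value into
    \<open>M z z *v c\<close>. Inverting the Gram matrix expresses the outcome through the value
    itself. On the circle all transforms vanish, so 0 serves.\<close>
  define R where "R z = (if z \<in> off_circle then M z z ** matrix_inv (A.gram z z) else 0)" for z
  have R: "R z *v hat HA \<Gamma>A f z = hat HB \<Gamma>B (X f) z" if f: "f \<in> hcarrier HA" for f z
  proof (cases "z \<in> off_circle")
    case z: True
    obtain c where c: "A.gram z z *v c = hat HA \<Gamma>A f z"
      using A.hat_surj[OF z] .
    have "R z *v hat HA \<Gamma>A f z = (M z z ** (matrix_inv (A.gram z z) ** A.gram z z)) *v c"
      using z by (simp add: R_def matrix_vector_mul_assoc matrix_mul_assoc del: Compl_iff flip: c)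
    also have "\<dots> = M z z *v c"
    proof -
      have "matrix_inv (A.gram z z) ** A.gram z z = mat 1"
        using A.gram_invertible[OF z] unfolding invertible_def matrix_inv_def
        by (rule someI2_ex) auto
      then show ?thesis
        by simp
    qed
    also have "\<dots> = hat HB \<Gamma>B (X f) z"
      using M[OF z z] fibre[OF A.\<Gamma>_carrier[OF z] f z] c A.gram_mult[OF z z] by simp
    finally show ?thesis .
  qed (simp add: A.hat_circle B.hat_circle del: Compl_iff)
  \<comment> \<open>The formula defining \<open>R\<close> does not show analyticity, as
    \<open>z\<close> also enters through the anti-analytic \<open>\<Gamma>A z\<close>. With the
    first argument frozen at \<open>w\<close>, the entries of both known matrices are analytic in
    \<open>z\<close>.\<close>
  have RG: "R z ** A.gram w z = M w z" if w: "w \<in> off_circle" and z: "z \<in> off_circle" for w z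
  proof -
    have "(R z ** A.gram w z) *v c = M w z *v c" for c
      using R[OF A.\<Gamma>_carrier[OF w], of z c] A.gram_mult[OF w z] M[OF w z]
      by (simp flip: matrix_vector_mul_assoc)
    then show ?thesis
      by (simp add: matrix_eq)
  qed
  have "(\<lambda>z. R z $ i $ k) analytic_on off_circle" for i k
  proof -
    have "(\<lambda>z. R z $ i $ k) field_differentiable at w" if w: "w \<in> off_circle" for w
    proof -
      have op: "open off_circle"
        by (simp add: open_Compl)
      have G: "(\<lambda>z. A.gram w z $ l $ j) holomorphic_on off_circle" for l j
        using A.hat_holomorphic[OF A.\<Gamma>_carrier[OF w]] by (simp add: A.gram_def)
      have Mh: "(\<lambda>z. M w z $ l $ j) holomorphic_on off_circle" for l j
        using B.hat_holomorphic[OF Xc[OF A.\<Gamma>_carrier[OF w]]] by (simp add: M_def)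
      \<comment> \<open>A neighbourhood of \<open>w\<close>, because \<open>A.gram w w\<close> is
        invertible; on it Cramer's rule gives \<open>R\<close>.\<close>
      define U where "U = {z \<in> off_circle. det (A.gram w z) \<noteq> 0}"
      have dG: "(\<lambda>z. det (A.gram w z)) holomorphic_on off_circle"
        by (rule holomorphic_on_det[OF G])
      have "open ((\<lambda>z. det (A.gram w z)) -` (- {0}) \<inter> off_circle)"
        using continuous_open_preimage[OF holomorphic_on_imp_continuous_on[OF dG] op, of "- {0}"]
        by (simp add: Int_commute open_Compl)
      moreover have "U = (\<lambda>z. det (A.gram w z)) -` (- {0}) \<inter> off_circle"
        by (auto simp: U_def)
      ultimately have U: "open U" "w \<in> U"
        using A.gram_invertible[OF w] w by (auto simp: U_def invertible_det_nz)
      have sub: "U \<subseteq> off_circle"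
        by (auto simp: U_def)
      have "(\<lambda>z. if j = k then M w z $ i $ l else A.gram w z $ j $ l) holomorphic_on U" for j l
        using holomorphic_on_subset[OF G sub] holomorphic_on_subset[OF Mh sub] by (cases "j = k") simp_all
      then have num: "(\<lambda>z. det (\<chi> l j. if j = k then M w z $ i $ l else A.gram w z $ j $ l)) holomorphic_on U"
        by (intro holomorphic_on_det) simp
      have "(\<lambda>z. det (\<chi> l j. if j = k then M w z $ i $ l else A.gram w z $ j $ l) / det (A.gram w z)) holomorphic_on U"
        by (intro holomorphic_on_divide num holomorphic_on_subset[OF dG sub]) (simp add: U_def)
      then have "(\<lambda>z. R z $ i $ k) holomorphic_on U"
        by (rule holomorphic_transform) (simp add: cramer_matrix[OF RG[OF w]] U_def)
      then show ?thesis
        using U by (simp add: holomorphic_on_open field_differentiable_def)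
    qed
    then have "(\<lambda>z. R z $ i $ k) holomorphic_on off_circle"
      unfolding holomorphic_on_def using field_differentiable_at_within by blast
    then show ?thesis
      by (simp add: analytic_on_open open_Compl)
  qed
  moreover have mult: "mult_by R (hat HA \<Gamma>A f) = hat HB \<Gamma>B (X f)" if "f \<in> hcarrier HA" for f
    using R[OF that] by (auto simp: mult_by_def)
  ultimately have "is_multiplier A.K B.K R"
    by (auto simp: is_multiplier_def)
  moreover have "inj_on (mult_by R) (hcarrier A.K)"
    using X(2) by (auto simp: inj_on_def mult)
  ultimately show ?thesis
    by (rule that)
qed

lemma quasi_le_if_multiplier:
  assumes R: "is_multiplier A.K B.K R" and inj: "inj_on (mult_by R) (hcarrier A.K)"
  shows "quasi_le HA A HB B"
proof -
  define X where "X f = inv_into (hcarrier HB) (hat HB \<Gamma>B) (mult_by R (hat HA \<Gamma>A f))" for f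
  have "mult_by R (hat HA \<Gamma>A f) \<in> hat HB \<Gamma>B ` hcarrier HB" if "f \<in> hcarrier HA" for f
    using R that by (auto simp: is_multiplier_def)
  then have Xc [simp]: "X f \<in> hcarrier HB" and X: "hat HB \<Gamma>B (X f) = mult_by R (hat HA \<Gamma>A f)"
    if "f \<in> hcarrier HA" for f
    using that unfolding X_def by (auto intro: inv_into_into f_inv_into_f)
  have add: "X (x + y) = X x + X y" if "x \<in> hcarrier HA" "y \<in> hcarrier HA" for x y
  proof -
    have "hat HB \<Gamma>B (X (x + y)) = hat HB \<Gamma>B (X x + X y)"
      using that by (simp add: X mult_by_def fun_eq_iff matrix_vector_right_distrib flip: A.hat_add B.hat_add)
    then show ?thesis
      using that by simp
  qed
  have scale: "X (hscale HA c x) = hscale HB c (X x)" if "x \<in> hcarrier HA" for c x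
  proof -
    have "hat HB \<Gamma>B (X (hscale HA c x)) = hat HB \<Gamma>B (hscale HB c (X x))"
      using that by (simp add: X mult_by_def fun_eq_iff vector_scalar_commute flip: A.hat_scale B.hat_scale)
    then show ?thesis
      using that by simp
  qed
  \<comment> \<open>These vectors represent the coordinates of transforms in the second model. A
    vector orthogonal to all of them has transform 0 and so is 0.\<close>
  define S where "S = {\<Gamma>B w (axis i 1) | w i. w \<in> off_circle}"
  have "bounded_operator HA HB X"
  proof (rule bounded_if_formal_adjoint_dense[where S = S])
    show "orth HB S = {0}"
    proof safe
      fix f
      assume f: "f \<in> orth HB S"
      then have fc: "f \<in> hcarrier HB"
        by (simp add: orth_def)
      have "0 = hat HB \<Gamma>B f"
        by (rule B.hat_eqI[OF fc]) (use f in \<open>auto simp: orth_def S_def\<close>)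
      then show "f = 0"
        using B.hat_eq_0 fc by simp
    next
      show "0 \<in> orth HB S"
        by (auto simp: orth_def S_def)
    qed
    fix s
    assume "s \<in> S"
    then obtain w i where w: "w \<in> off_circle" and s: "s = \<Gamma>B w (axis i 1)"
      by (auto simp: S_def)
    \<comment> \<open>The formal adjoint of a multiplication operator on kernel vectors:
      \<open>\<Gamma>B w (axis i 1)\<close> goes to \<open>\<Gamma>A w\<close> of the conjugated row
      \<open>i\<close> of \<open>R w\<close>, which is the adjoint matrix applied to
      \<open>axis i 1\<close>.\<close>
    have "hinner HB (X f) s = hinner HA f (\<Gamma>A w (\<chi> j. cnj (R w $ i $ j)))" if f: "f \<in> hcarrier HA" for f
    proof -
      have "hinner HB (X f) s = (R w *v hat HA \<Gamma>A f w) $ i"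
        using X[OF f] B.hat_nth[OF w Xc[OF f], of i] by (simp add: s mult_by_def)
      also have "\<dots> = hinner HA f (\<Gamma>A w (\<chi> j. cnj (R w $ i $ j)))"
        unfolding A.inner_\<Gamma>_right[OF w f, of "\<chi> j. cnj (R w $ i $ j)"] matrix_vector_mult_def
        by (simp add: A.hat_nth[OF w f])
      finally show ?thesis .
    qed
    then show "s \<in> hcarrier HB \<and> (\<exists>h\<in>hcarrier HA. \<forall>x\<in>hcarrier HA. hinner HB (X x) s = hinner HA x h)"
      using w s A.\<Gamma>_carrier[OF w] B.\<Gamma>_carrier[OF w] by blast
  qed (use add scale A.hilbert_space_axioms B.hilbert_space_axioms in auto)
  moreover have "inj_on X (hcarrier HA)"
  proof (rule inj_onI)
    fix x y
    assume "x \<in> hcarrier HA" "y \<in> hcarrier HA" "X x = X y"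
    then show "x = y"
      using X[of x] X[of y] inj_onD[OF inj, of "hat HA \<Gamma>A x" "hat HA \<Gamma>A y"] by simp
  qed
  moreover have "X x \<in> B.initial \<and> X (A x) = B (X x)" if x: "x \<in> A.initial" for x
  proof -
    have xc: "x \<in> hcarrier HA"
      using x by (rule A.initial_carrier)
    \<comment> \<open>Multiplication by \<open>z\<close> commutes with \<open>R\<close>. This single
      identity puts \<open>z\<close> times the transform of \<open>X x\<close> into the second
      model, so \<open>X x\<close> is in the initial space, and then also gives the intertwining
      relation.\<close>
    have eq: "mult_z (hat HB \<Gamma>B (X x)) = hat HB \<Gamma>B (X (A x))"
      using xc by (simp add: X A.mult_z_hat[OF x] flip: mult_by_mult_z)
    then have init: "X x \<in> B.initial"
      using B.mult_z_hat_in_model[of "X x"] xc by simp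
    then have "hat HB \<Gamma>B (B (X x)) = hat HB \<Gamma>B (X (A x))"
      using eq B.mult_z_hat by simp
    then show ?thesis
      using init xc by simp
  qed
  ultimately show ?thesis
    unfolding quasi_le_def by blast
qed

end

text \<open>The dimension \<open>n\<close> is \<open>CARD('n)\<close>, hence finite and at least 1.
  Injectivity of \<open>mult_by R\<close> in the third condition corresponds to the injectivity of
  the intertwiner in \<open>quasi_le\<close>.\<close>

theorem theorem8p1:
  fixes HA :: "'a::ab_group_add hspace" and HB :: "'b::ab_group_add hspace"
    and A :: "'a \<Rightarrow> 'a" and B :: "'b \<Rightarrow> 'b"
    and \<Gamma>A :: "complex \<Rightarrow> complex ^ 'n \<Rightarrow> 'a" and \<Gamma>B :: "complex \<Rightarrow> complex ^ 'n \<Rightarrow> 'b"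
  assumes "separable_hilbert_space HA" and "separable_hilbert_space HB"
    and "A \<in> cnu_partial_isometries CARD('n) HA"
    and "B \<in> cnu_partial_isometries CARD('n) HB"
    and "is_model HA A \<Gamma>A" and "is_model HB B \<Gamma>B"
  shows "(quasi_le HA A HB B \<longleftrightarrow>
            quasi_le (model_space HA \<Gamma>A) (model_shift (model_space HA \<Gamma>A))
                     (model_space HB \<Gamma>B) (model_shift (model_space HB \<Gamma>B)))
       \<and> (quasi_le HA A HB B \<longleftrightarrow>
            (\<exists>R. is_multiplier (model_space HA \<Gamma>A) (model_space HB \<Gamma>B) R
                 \<and> inj_on (mult_by R) (hcarrier (model_space HA \<Gamma>A))))"
proof -
  interpret model_pair HA HB A B \<Gamma>A \<Gamma>B
    unfolding model_pair_def using assms by (intro conjI modelI)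
  show ?thesis
    using quasi_le_model_if_quasi_le quasi_le_if_quasi_le_model multiplier_if_quasi_le
      quasi_le_if_multiplier by metis
qed

end
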